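(* Let $R$ be a Dedekind domain whose Picard group has prime order $p$, and let $n\ge1$. Then $$\operatorname{fe}_R(R^n)=\sum_{k=1}^n\Big[\nu(n,k,p)\,p^k+\nu'(n,k,p)\,p^{k-1}\Big].$$
   Context: $\operatorname{Pic}(R)$ is the group of isomorphism classes of rank-one projective $R$-modules under $\otimes_R$; ranks are $\operatorname{rk}(P)=\dim_K(P\otimes_RK)$ with $K$ the fraction field. For a finitely generated projective $R$-module $X$ of rank $n$, $\operatorname{fe}_R(X)$ is the number of feedback classes of regular linear systems over $R$ with state space $X$, which (standing fact) equals the number of $n$-tuples $(Z_1,\dots,Z_n)$ of isomorphism classes of finitely generated projective $R$-modules with $X\cong Z_1\oplus Z_2^{\oplus2}\oplus\cdots\oplus Z_n^{\oplus n}$. For $1\le k\le n$, $\nu(n,k)$ is the number of partitions of $n$ with exactly $k$ distinct part sizes (equivalently, of $(z_1,\dots,z_n)\in\mathbb N^n$ with $\sum_i iz_i=n$ and exactly $k$ nonzero entries); $\nu(n,k,p)$ is the number of those partitions all of whose distinct part sizes are multiples of $p$ (e.g. $\nu(6,2,2)=1$, from $42$); and $\nu'(n,k,p)=\nu(n,k)-\nu(n,k,p)$. *)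

theory Defs
  imports "HOL-Computational_Algebra.Fraction_Field" "HOL-Computational_Algebra.Polynomial"
begin

definition r_ideal :: "'a::comm_ring_1 set \<Rightarrow> bool" where
  "r_ideal I \<longleftrightarrow> 0 \<in> I \<and> (\<forall>x\<in>I. \<forall>y\<in>I. x + y \<in> I) \<and> (\<forall>r x. x \<in> I \<longrightarrow> r * x \<in> I)"

definition r_fin_gen_ideal :: "'a::comm_ring_1 set \<Rightarrow> bool" where
  "r_fin_gen_ideal I \<longleftrightarrow> (\<exists>F. finite F \<and> I = {\<Sum>f\<in>F. c f * f | c. True})"

definition r_prime_ideal :: "'a::comm_ring_1 set \<Rightarrow> bool" where
  "r_prime_ideal I \<longleftrightarrow> r_ideal I \<and> I \<noteq> UNIV \<and> (\<forall>a b. a * b \<in> I \<longrightarrow> a \<in> I \<or> b \<in> I)"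

definition r_maximal_ideal :: "'a::comm_ring_1 set \<Rightarrow> bool" where
  "r_maximal_ideal I \<longleftrightarrow> r_ideal I \<and> I \<noteq> UNIV \<and>
     (\<forall>J. r_ideal J \<and> I \<subseteq> J \<longrightarrow> J = I \<or> J = UNIV)"

definition integrally_closed :: "'a::idom itself \<Rightarrow> bool" where
  "integrally_closed (_ :: 'a itself) \<longleftrightarrow>
     (\<forall>x :: 'a fract. (\<exists>q :: 'a poly. lead_coeff q = 1 \<and> poly (map_poly (\<lambda>a. Fraction_Field.Fract a 1) q) x = 0)
        \<longrightarrow> x \<in> range (\<lambda>a::'a. Fraction_Field.Fract a 1))"

definition dedekind_domain :: "'a::idom itself \<Rightarrow> bool" where
  "dedekind_domain T \<longleftrightarrow>
     (\<forall>I :: 'a set. r_ideal I \<longrightarrow> r_fin_gen_ideal I) \<and>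
     integrally_closed T \<and>
     (\<forall>I :: 'a set. r_prime_ideal I \<and> I \<noteq> {0} \<longrightarrow> r_maximal_ideal I)"

text \<open>Vectors of R^m are functions nat => R vanishing from index m on.  Every finitely
 generated projective module is (up to isomorphism) a direct summand of some R^m, so the
 iso classes of f.g. projective modules are exactly the iso classes of direct summands of
 the free modules R^m.\<close>

definition vscale :: "'a::comm_ring_1 \<Rightarrow> (nat \<Rightarrow> 'a) \<Rightarrow> (nat \<Rightarrow> 'a)" where
  "vscale r v = (\<lambda>i. r * v i)"

definition vadd :: "(nat \<Rightarrow> 'a::comm_ring_1) \<Rightarrow> (nat \<Rightarrow> 'a) \<Rightarrow> (nat \<Rightarrow> 'a)" where
  "vadd v w = (\<lambda>i. v i + w i)"

definition free_mod :: "nat \<Rightarrow> (nat \<Rightarrow> 'a::comm_ring_1) set" where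
  "free_mod m = {v. \<forall>i\<ge>m. v i = 0}"

definition submod :: "(nat \<Rightarrow> 'a::comm_ring_1) set \<Rightarrow> bool" where
  "submod M \<longleftrightarrow> (\<lambda>_. 0) \<in> M \<and> (\<forall>v\<in>M. \<forall>w\<in>M. vadd v w \<in> M) \<and> (\<forall>r. \<forall>v\<in>M. vscale r v \<in> M)"

definition fg_proj :: "(nat \<Rightarrow> 'a::comm_ring_1) set \<Rightarrow> bool" where
  "fg_proj P \<longleftrightarrow> (\<exists>m Q. submod P \<and> submod Q \<and> P \<subseteq> free_mod m \<and> Q \<subseteq> free_mod m \<and>
      P \<inter> Q = {\<lambda>_. 0} \<and> {vadd v w | v w. v \<in> P \<and> w \<in> Q} = free_mod m)"

definition lin_map_on :: "(nat \<Rightarrow> 'a::comm_ring_1) set \<Rightarrow> ((nat \<Rightarrow> 'a) \<Rightarrow> (nat \<Rightarrow> 'a)) \<Rightarrow> bool" where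
  "lin_map_on M f \<longleftrightarrow> (\<forall>v\<in>M. \<forall>w\<in>M. f (vadd v w) = vadd (f v) (f w)) \<and>
                     (\<forall>r. \<forall>v\<in>M. f (vscale r v) = vscale r (f v))"

definition mod_iso :: "(nat \<Rightarrow> 'a::comm_ring_1) set \<Rightarrow> (nat \<Rightarrow> 'a) set \<Rightarrow> bool" where
  "mod_iso M N \<longleftrightarrow> (\<exists>f. lin_map_on M f \<and> bij_betw f M N)"

definition iso_class :: "(nat \<Rightarrow> 'a::comm_ring_1) set \<Rightarrow> (nat \<Rightarrow> 'a) set set" where
  "iso_class P = {Q. fg_proj Q \<and> mod_iso P Q}"

definition fgp_classes :: "'a::comm_ring_1 itself \<Rightarrow> (nat \<Rightarrow> 'a) set set set" where
  "fgp_classes _ = iso_class ` {P. fg_proj P}"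

text \<open>Rank: dim_K (P tensor K).  For a submodule P of R^m over a domain this is the
 maximal number of R-linearly independent elements of P.\<close>
definition lin_indep :: "(nat \<Rightarrow> 'a::comm_ring_1) set \<Rightarrow> bool" where
  "lin_indep S \<longleftrightarrow> (\<forall>c. (\<lambda>i. \<Sum>s\<in>S. c s * s i) = (\<lambda>_. 0) \<longrightarrow> (\<forall>s\<in>S. c s = 0))"

definition mod_rank :: "(nat \<Rightarrow> 'a::comm_ring_1) set \<Rightarrow> nat" where
  "mod_rank P = Max {card S | S. finite S \<and> S \<subseteq> P \<and> lin_indep S}"

definition pic_classes :: "'a::comm_ring_1 itself \<Rightarrow> (nat \<Rightarrow> 'a) set set set" where
  "pic_classes _ = iso_class ` {P. fg_proj P \<and> mod_rank P = 1}"

definition is_dsum :: "(nat \<Rightarrow> 'a::comm_ring_1) set \<Rightarrow> (nat \<Rightarrow> 'a) set list \<Rightarrow> bool" where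
  "is_dsum X Ms \<longleftrightarrow> (\<exists>N :: nat \<Rightarrow> (nat \<Rightarrow> 'a) set.
      (\<forall>j<length Ms. submod (N j) \<and> N j \<subseteq> X \<and> mod_iso (N j) (Ms ! j)) \<and>
      (\<forall>x\<in>X. \<exists>!c. (\<forall>j<length Ms. c j \<in> N j) \<and> (\<forall>j\<ge>length Ms. c j = (\<lambda>_. 0)) \<and>
                  x = (\<lambda>i. \<Sum>j<length Ms. c j i)))"

text \<open>fe_R(X), X of rank n: number of n-tuples (Z_1,...,Z_n) of iso classes of f.g.
 projective modules with X iso to Z_1 + Z_2^2 + ... + Z_n^n.  Tuples are functions on
 {1..n} (padded with the empty set, which is not an iso class).\<close>
definition fe :: "(nat \<Rightarrow> 'a::comm_ring_1) set \<Rightarrow> nat" where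
  "fe X = card {Z :: nat \<Rightarrow> (nat \<Rightarrow> 'a) set set.
      (\<forall>i\<in>{1..mod_rank X}. Z i \<in> fgp_classes TYPE('a)) \<and>
      (\<forall>i. i \<notin> {1..mod_rank X} \<longrightarrow> Z i = {}) \<and>
      (\<exists>reps. (\<forall>i\<in>{1..mod_rank X}. reps i \<in> Z i) \<and>
         is_dsum X (concat (map (\<lambda>i. replicate i (reps i)) [1..<Suc (mod_rank X)])))}"

definition part_vecs :: "nat \<Rightarrow> (nat \<Rightarrow> nat) set" where
  "part_vecs n = {z. (\<forall>i. z i \<noteq> 0 \<longrightarrow> i \<in> {1..n}) \<and> (\<Sum>i=1..n. i * z i) = n}"

definition nu :: "nat \<Rightarrow> nat \<Rightarrow> nat" where
  "nu n k = card {z \<in> part_vecs n. card {i. z i \<noteq> 0} = k}"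

definition nu_p :: "nat \<Rightarrow> nat \<Rightarrow> nat \<Rightarrow> nat" where
  "nu_p n k p = card {z \<in> part_vecs n. card {i. z i \<noteq> 0} = k \<and> (\<forall>i. z i \<noteq> 0 \<longrightarrow> p dvd i)}"

definition nu' :: "nat \<Rightarrow> nat \<Rightarrow> nat \<Rightarrow> nat" where
  "nu' n k p = nu n k - nu_p n k p"

end

theory Submission
  imports Defs "Jordan_Normal_Form.Determinant" "HOL-Algebra.Multiplicative_Group"
    "HOL-Number_Theory.Cong" "HOL-Library.FuncSet"
begin

text \<open>By Steinitz' theorem a finitely generated projective module over a Dedekind domain is isomorphic
  to a direct sum of \<open>r\<close> nonzero ideals, and it is determined by its rank \<open>r\<close> together with the class of
  the product of these ideals. The ideal class group is identified with the Picard group, so it is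
  cyclic of order \<open>p\<close> and the class is an exponent \<open>e\<close> modulo \<open>p\<close>. A tuple with ranks \<open>z\<^sub>i\<close> and
  exponents \<open>e\<^sub>i\<close> (with \<open>e\<^sub>i = 0\<close> if \<open>z\<^sub>i = 0\<close>) then decomposes the free module of rank \<open>n\<close> iff
  \<open>\<Sum> i z\<^sub>i = n\<close> and \<open>p\<close> divides \<open>\<Sum> i e\<^sub>i\<close>. If \<open>z\<close> has \<open>k\<close> nonzero entries, this congruence has
  \<open>p\<^sup>k\<close> solutions when \<open>p\<close> divides all indices of the support of \<open>z\<close>, and a \<open>p\<close>-th part of that otherwise.\<close>

subsection \<open>Ideals of a Dedekind domain\<close>

text \<open>No fractional ideals occur. Ideal classes are classes of integral ideals modulo nonzero
  principal factors, and the inverse of I is represented by the conductor of all b with bI inside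
  (c), that is c I^{-1}, for a nonzero c in I. Invertibility of I is the one place where integral
  closedness enters. It yields the splitting of projections onto ideals, and also the coprime
  representatives behind the isomorphism between the direct sum of I and J and that of IJ and R. The
  obstacle in Steinitz' theorem is the invariance of the product class. A determinant settles it
  when one of the modules is free; the general case is reduced to this one by adding an ideal of the
  inverse class to both sides. In the count, the congruence is linear in the exponents with the
  indices as coefficients. An index of the support that is prime to \<open>p\<close> lets its
  exponent be solved for, which costs one factor \<open>p\<close>; if there is no such index, the
  congruence is vacuous.\<close>

lemma r_idealI:
  assumes "0 \<in> I" "\<And>x y. x \<in> I \<Longrightarrow> y \<in> I \<Longrightarrow> x + y \<in> I" "\<And>r x. x \<in> I \<Longrightarrow> r * x \<in> I"
  shows "r_ideal I"
  using assms by (auto simp: r_ideal_def)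

lemma r_ideal_zero: "r_ideal I \<Longrightarrow> 0 \<in> I"
  and r_ideal_add: "r_ideal I \<Longrightarrow> x \<in> I \<Longrightarrow> y \<in> I \<Longrightarrow> x + y \<in> I"
  and r_ideal_mult: "r_ideal I \<Longrightarrow> x \<in> I \<Longrightarrow> r * x \<in> I"
  by (auto simp: r_ideal_def)

lemma r_ideal_uminus: "r_ideal I \<Longrightarrow> x \<in> I \<Longrightarrow> - x \<in> I"
  using r_ideal_mult[of I x "-1"] by simp

lemma r_ideal_diff: "r_ideal I \<Longrightarrow> x \<in> I \<Longrightarrow> y \<in> I \<Longrightarrow> x - y \<in> I"
  using r_ideal_add[of I x "- y"] r_ideal_uminus[of I y] by simp

lemma r_ideal_mult_right: "r_ideal I \<Longrightarrow> x \<in> I \<Longrightarrow> x * r \<in> I"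
  using r_ideal_mult[of I x r] by (simp add: mult.commute)

lemma r_ideal_sum:
  assumes "r_ideal I" "\<And>i. i \<in> S \<Longrightarrow> f i \<in> I"
  shows "(\<Sum>i\<in>S. f i) \<in> I"
  using assms(2)
  by (induction S rule: infinite_finite_induct) (auto intro: r_ideal_zero r_ideal_add assms(1))

lemma r_ideal_UNIV: "r_ideal UNIV"
  by (auto simp: r_ideal_def)

lemma r_ideal_eq_UNIV_iff: "r_ideal I \<Longrightarrow> I = UNIV \<longleftrightarrow> 1 \<in> I"
  using r_ideal_mult[of I 1] by auto

lemma r_ideal_principal: "r_ideal {x. a dvd x}"
  by (auto simp: r_ideal_def)

definition ideal_sum :: "'a::comm_ring_1 set \<Rightarrow> 'a set \<Rightarrow> 'a set" where
  "ideal_sum I J = {x + y | x y. x \<in> I \<and> y \<in> J}"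

lemma r_ideal_ideal_sum:
  assumes "r_ideal I" "r_ideal J"
  shows "r_ideal (ideal_sum I J)"
proof (rule r_idealI)
  show "0 \<in> ideal_sum I J"
    unfolding ideal_sum_def using r_ideal_zero[OF assms(1)] r_ideal_zero[OF assms(2)] by force
next
  fix x y assume "x \<in> ideal_sum I J" "y \<in> ideal_sum I J"
  then obtain a b c d where "x = a + b" "y = c + d" "a \<in> I" "b \<in> J" "c \<in> I" "d \<in> J"
    unfolding ideal_sum_def by blast
  then have "x + y = (a + c) + (b + d)" "a + c \<in> I" "b + d \<in> J"
    using assms by (auto intro: r_ideal_add)
  then show "x + y \<in> ideal_sum I J" unfolding ideal_sum_def by blast
next
  fix r x assume "x \<in> ideal_sum I J"
  then obtain a b where "x = a + b" "a \<in> I" "b \<in> J"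
    unfolding ideal_sum_def by blast
  then have "r * x = r * a + r * b" "r * a \<in> I" "r * b \<in> J"
    using assms by (auto intro: r_ideal_mult simp: distrib_left)
  then show "r * x \<in> ideal_sum I J" unfolding ideal_sum_def by blast
qed

lemma ideal_sum_upper:
  assumes "r_ideal I" "r_ideal J"
  shows "I \<subseteq> ideal_sum I J" "J \<subseteq> ideal_sum I J"
proof -
  show "I \<subseteq> ideal_sum I J"
  proof
    fix x assume "x \<in> I"
    then have "x = x + 0 \<and> x \<in> I \<and> 0 \<in> J" using r_ideal_zero[OF assms(2)] by simp
    then show "x \<in> ideal_sum I J" unfolding ideal_sum_def by blast
  qed
  show "J \<subseteq> ideal_sum I J"
  proof
    fix x assume "x \<in> J"
    then have "x = 0 + x \<and> 0 \<in> I \<and> x \<in> J" using r_ideal_zero[OF assms(1)] by simp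
    then show "x \<in> ideal_sum I J" unfolding ideal_sum_def by blast
  qed
qed

text \<open>The intersection form gives the product a universal property: an inclusion of products
  is checked on elements \<open>x * y\<close> alone, and no finite sums of products have to be
  handled.\<close>

definition ideal_prod :: "'a::comm_ring_1 set \<Rightarrow> 'a set \<Rightarrow> 'a set" where
  "ideal_prod I J = \<Inter>{K. r_ideal K \<and> (\<forall>x\<in>I. \<forall>y\<in>J. x * y \<in> K)}"

lemma r_ideal_ideal_prod: "r_ideal (ideal_prod I J)"
  unfolding ideal_prod_def r_ideal_def by blast

lemma ideal_prod_memI: "x \<in> I \<Longrightarrow> y \<in> J \<Longrightarrow> x * y \<in> ideal_prod I J"
  unfolding ideal_prod_def by blast

lemma ideal_prod_least:
  "r_ideal K \<Longrightarrow> (\<And>x y. x \<in> I \<Longrightarrow> y \<in> J \<Longrightarrow> x * y \<in> K) \<Longrightarrow> ideal_prod I J \<subseteq> K"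
  unfolding ideal_prod_def by blast

lemma ideal_prod_commute: "ideal_prod I J = ideal_prod J I"
  unfolding ideal_prod_def by (metis mult.commute)

lemma r_ideal_colon: "r_ideal K \<Longrightarrow> r_ideal {x. \<forall>z\<in>S. x * z \<in> K}"
  by (auto simp: r_ideal_def distrib_right mult.assoc)

text \<open>The elements that multiply all of \<open>K\<close> into the right-hand side form an
  ideal, so it is enough to test products of an element of \<open>I\<close> with one of
  \<open>J\<close>.\<close>

lemma ideal_prod_assoc_le: "ideal_prod (ideal_prod I J) K \<subseteq> ideal_prod I (ideal_prod J K)"
proof (rule ideal_prod_least[OF r_ideal_ideal_prod])
  fix x y assume x: "x \<in> ideal_prod I J" and y: "y \<in> K"
  have "ideal_prod I J \<subseteq> {x. \<forall>z\<in>K. x * z \<in> ideal_prod I (ideal_prod J K)}"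
    by (rule ideal_prod_least) (auto intro!: r_ideal_colon r_ideal_ideal_prod ideal_prod_memI simp: mult.assoc)
  then show "x * y \<in> ideal_prod I (ideal_prod J K)" using x y by blast
qed

lemma ideal_prod_assoc: "ideal_prod (ideal_prod I J) K = ideal_prod I (ideal_prod J K)"
proof
  show "ideal_prod I (ideal_prod J K) \<subseteq> ideal_prod (ideal_prod I J) K"
    using ideal_prod_assoc_le[of K J I] by (simp add: ideal_prod_commute)
qed (rule ideal_prod_assoc_le)

lemma ideal_prod_UNIV: "r_ideal I \<Longrightarrow> ideal_prod UNIV I = I"
  using ideal_prod_least[of I UNIV I] ideal_prod_memI[of 1 UNIV _ I]
  by (auto intro: r_ideal_mult)

lemma ideal_prod_subset: "r_ideal I \<Longrightarrow> ideal_prod I J \<subseteq> I"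
  by (rule ideal_prod_least) (auto intro: r_ideal_mult_right)

lemma r_maximal_imp_prime:
  assumes "r_maximal_ideal P"
  shows "r_prime_ideal P"
proof -
  have P: "r_ideal P" "P \<noteq> UNIV" "\<And>J. r_ideal J \<Longrightarrow> P \<subseteq> J \<Longrightarrow> J = P \<or> J = UNIV"
    using assms by (auto simp: r_maximal_ideal_def)
  have "b \<in> P" if ab: "a * b \<in> P" and a: "a \<notin> P" for a b
  proof -
    let ?J = "ideal_sum P {x. a dvd x}"
    have J: "r_ideal ?J" "P \<subseteq> ?J" "a \<in> ?J"
      using r_ideal_ideal_sum[OF P(1) r_ideal_principal[of a]]
        ideal_sum_upper[OF P(1) r_ideal_principal[of a]] by auto
    then have "1 \<in> ?J" using P(3)[of ?J] a by auto
    then obtain x r where x: "x \<in> P" "1 = x + a * r"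
      unfolding ideal_sum_def by (auto simp: dvd_def)
    have "b = b * x + r * (a * b)" using x(2) by (metis distrib_left mult.commute mult.left_commute mult.right_neutral)
    then show ?thesis using x(1) ab P(1) by (metis r_ideal_add r_ideal_mult)
  qed
  then show ?thesis using P by (auto simp: r_prime_ideal_def)
qed

lemma r_prime_idealD: "r_prime_ideal P \<Longrightarrow> a * b \<in> P \<Longrightarrow> a \<in> P \<or> b \<in> P"
  by (auto simp: r_prime_ideal_def)

locale dedekind =
  fixes T :: "'a::idom itself"
  assumes dedekind: "dedekind_domain TYPE('a)"
begin

lemma noetherian: "r_ideal (I :: 'a set) \<Longrightarrow> r_fin_gen_ideal I"
  and integrally_closed: "integrally_closed TYPE('a)"
  and prime_imp_maximal: "r_prime_ideal (P :: 'a set) \<Longrightarrow> P \<noteq> {0} \<Longrightarrow> r_maximal_ideal P"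
  using dedekind by (auto simp: dedekind_domain_def)

end

lemma degree_bounded_poly_eq_sum:
  fixes q :: "'b::comm_ring_1 poly"
  assumes "Polynomial.degree q \<le> n"
  shows "poly q x = (\<Sum>i\<le>n. Polynomial.coeff q i * x ^ i)"
proof -
  have "(\<Sum>i\<le>n. Polynomial.coeff q i * x ^ i) = (\<Sum>i\<le>Polynomial.degree q. Polynomial.coeff q i * x ^ i)"
    by (rule sum.mono_neutral_right) (use assms in \<open>auto simp: coeff_eq_0\<close>)
  then show ?thesis by (simp add: poly_altdef)
qed

lemma sum_Fract_1: "(\<Sum>i\<in>S. Fraction_Field.Fract (f i :: 'a::idom) 1) = Fraction_Field.Fract (\<Sum>i\<in>S. f i) 1"
  by (induction S rule: infinite_finite_induct) (auto simp: Zero_fract_def)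

lemma power_Fract_1: "Fraction_Field.Fract x 1 ^ k = Fraction_Field.Fract (x ^ k :: 'a::idom) 1"
  by (induction k) (auto simp: One_fract_def)

section \<open>Noetherian arguments, invertibility of ideals, maximal ideals above an ideal\<close>

context dedekind
begin

text \<open>Zorn's lemma applies because the union of a chain is an ideal with finitely many
  generators; these already lie in one member of the chain, which is therefore the union.\<close>

lemma ideal_family_has_maximal:
  fixes F :: "'a set set"
  assumes "F \<noteq> {}" and F: "\<And>I. I \<in> F \<Longrightarrow> r_ideal I"
  shows "\<exists>M\<in>F. \<forall>J\<in>F. M \<subseteq> J \<longrightarrow> J = M"
proof (rule subset_Zorn_nonempty[OF assms(1)])
  fix C assume C: "C \<noteq> {}" "subset.chain F C"
  have CF: "C \<subseteq> F" and lin: "\<And>X Y. X \<in> C \<Longrightarrow> Y \<in> C \<Longrightarrow> X \<subseteq> Y \<or> Y \<subseteq> X"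
    using C(2) by (auto simp: subset_chain_def)
  have "r_ideal (\<Union>C)"
  proof (rule r_idealI)
    show "0 \<in> \<Union>C" using C(1) CF F r_ideal_zero by blast
    show "x + y \<in> \<Union>C" if xy: "x \<in> \<Union>C" "y \<in> \<Union>C" for x y
    proof -
      obtain X Y where XY: "X \<in> C" "Y \<in> C" "x \<in> X" "y \<in> Y" using xy by blast
      then obtain Z where "Z \<in> C" "x \<in> Z" "y \<in> Z" using lin by blast
      then show ?thesis using CF F r_ideal_add by blast
    qed
    show "r * x \<in> \<Union>C" if "x \<in> \<Union>C" for r x
      using that CF F r_ideal_mult by blast
  qed
  then obtain G where G: "finite G" "\<Union>C = {\<Sum>f\<in>G. c f * f | c. True}"
    using noetherian[of "\<Union>C"] by (auto simp: r_fin_gen_ideal_def)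
  have "G \<subseteq> \<Union>C"
  proof
    fix g assume g: "g \<in> G"
    have "g = (\<Sum>f\<in>G. (if f = g then 1 else 0) * f)"
      using G(1) g by (simp add: if_distrib[of "\<lambda>x. x * _"] cong: if_cong)
    then have "g \<in> {\<Sum>f\<in>G. c f * f | c. True}"
      by (intro CollectI exI[of _ "\<lambda>f. if f = g then 1 else 0"] conjI TrueI)
    then show "g \<in> \<Union>C" using G(2) by blast
  qed
  then obtain X where X: "X \<in> C" "G \<subseteq> X"
    using finite_subset_Union_chain[OF G(1) _ C] by blast
  have "r_ideal X" using X(1) CF F by blast
  then have "\<Union>C \<subseteq> X"
    unfolding G(2) using X(2) by (auto intro!: r_ideal_sum r_ideal_mult)
  then have "\<Union>C = X" using X(1) by blast
  then show "\<Union>C \<in> F" using X(1) CF by blast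
qed

text \<open>The indexed form serves families such as conductors of elements or an ascending sequence
  of ideals, where the parameter of a maximal member is wanted and not only the ideal.\<close>

lemma maximal_ideal_in_familyE:
  fixes C :: "'i \<Rightarrow> 'a set"
  assumes "Q i" "\<And>i. Q i \<Longrightarrow> r_ideal (C i)"
  obtains m where "Q m" "\<And>j. Q j \<Longrightarrow> C m \<subseteq> C j \<Longrightarrow> C j = C m"
proof -
  have "\<exists>M\<in>C ` Collect Q. \<forall>J\<in>C ` Collect Q. M \<subseteq> J \<longrightarrow> J = M"
    by (rule ideal_family_has_maximal) (use assms in auto)
  then show ?thesis using that by (auto simp: Bex_def Ball_def)
qed

lemma exists_maximal_ideal:
  assumes "r_ideal (I :: 'a set)" "1 \<notin> I"
  shows "\<exists>P. r_maximal_ideal P \<and> I \<subseteq> P"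
proof -
  let ?F = "{J. r_ideal J \<and> I \<subseteq> J \<and> 1 \<notin> J}"
  have "I \<in> ?F" using assms by simp
  then obtain M where M: "M \<in> ?F" "\<And>J. J \<in> ?F \<Longrightarrow> M \<subseteq> J \<Longrightarrow> J = M"
    by (rule maximal_ideal_in_familyE[of "\<lambda>J. J \<in> ?F" I "\<lambda>J. J"]) (simp, blast)
  have "r_maximal_ideal M"
    unfolding r_maximal_ideal_def using M r_ideal_eq_UNIV_iff by auto
  then show ?thesis using M by blast
qed

text \<open>For \<open>x = a / b\<close> and \<open>0 \<noteq> d \<in> I\<close> all \<open>d * x ^ k\<close> lie in \<open>I\<close>; the Noetherian property
  applied to the ideals they span yields an equation of integral dependence for \<open>x\<close>.\<close>

lemma dvd_if_scaled_ideal_subset: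
  fixes a b :: 'a
  assumes I: "r_ideal I" "I \<noteq> {0}" and b: "b \<noteq> 0"
    and sub: "\<And>t. t \<in> I \<Longrightarrow> \<exists>s\<in>I. a * t = b * s"
  shows "b dvd a"
proof -
  obtain d where d: "d \<in> I" "d \<noteq> 0" using I r_ideal_zero by blast
  \<comment> \<open>This states that d (a / b)^k lies in \<open>I\<close> without leaving the ring;
    the element \<open>y\<close> is that quotient.\<close>
  have "\<exists>y\<in>I. b ^ k * y = a ^ k * d" for k
  proof (induction k)
    case 0 then show ?case using d by auto
  next
    case (Suc k)
    then obtain y where y: "y \<in> I" "b ^ k * y = a ^ k * d" by blast
    obtain s where s: "s \<in> I" "a * y = b * s" using sub[OF y(1)] by blast
    have "b ^ Suc k * s = b ^ k * (a * y)" by (simp add: s(2))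
    also have "\<dots> = a ^ Suc k * d" using y(2) by (simp add: algebra_simps)
    finally show ?case using s(1) by blast
  qed
  then obtain y where y: "\<And>k. b ^ k * y k = a ^ k * d" by metis
  define J where "J N = {\<Sum>k\<le>N. c k * y k | c. True}" for N :: nat
  have "r_ideal (J N)" for N
  proof (rule r_idealI)
    have "0 = (\<Sum>k\<le>N. 0 * y k)" by simp
    then show "0 \<in> J N" unfolding J_def by (intro CollectI exI[of _ "\<lambda>_. 0"] conjI TrueI)
  next
    fix u v assume "u \<in> J N" "v \<in> J N"
    then obtain c c' where "u = (\<Sum>k\<le>N. c k * y k)" "v = (\<Sum>k\<le>N. c' k * y k)"
      unfolding J_def by blast
    then have "u + v = (\<Sum>k\<le>N. (c k + c' k) * y k)" by (simp add: sum.distrib distrib_right)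
    then show "u + v \<in> J N"
      unfolding J_def by (intro CollectI exI[of _ "\<lambda>k. c k + c' k"] conjI TrueI)
  next
    fix r u assume "u \<in> J N"
    then obtain c where "u = (\<Sum>k\<le>N. c k * y k)" unfolding J_def by blast
    then have "r * u = (\<Sum>k\<le>N. (r * c k) * y k)" by (simp add: sum_distrib_left mult.assoc)
    then show "r * u \<in> J N"
      unfolding J_def by (intro CollectI exI[of _ "\<lambda>k. r * c k"] conjI TrueI)
  qed
  then obtain N where N: "\<And>K. J N \<subseteq> J K \<Longrightarrow> J K = J N"
    using maximal_ideal_in_familyE[of "\<lambda>_. True" _ J] by auto
  have "J N \<subseteq> J (Suc N)"
  proof
    fix u assume "u \<in> J N"
    then obtain c where "u = (\<Sum>k\<le>N. c k * y k)" unfolding J_def by blast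
    then have "u = (\<Sum>k\<le>Suc N. (if k \<le> N then c k else 0) * y k)" by simp
    then show "u \<in> J (Suc N)"
      unfolding J_def by (intro CollectI exI[of _ "\<lambda>k. if k \<le> N then c k else 0"] conjI TrueI)
  qed
  then have "J (Suc N) = J N" by (rule N)
  moreover have "y (Suc N) \<in> J (Suc N)"
  proof -
    have "y (Suc N) = (\<Sum>k\<le>Suc N. (if k = Suc N then 1 else 0) * y k)" by simp
    then show ?thesis
      unfolding J_def by (intro CollectI exI[of _ "\<lambda>k. if k = Suc N then 1 else 0"] conjI TrueI)
  qed
  \<comment> \<open>The ascending sequence is stationary at \<open>N\<close>. Divided by
    \<open>d\<close> in the fraction field, this relation is the equation of integral dependence of
    degree \<open>Suc N\<close>.\<close>
  ultimately obtain c where c: "y (Suc N) = (\<Sum>k\<le>N. c k * y k)" unfolding J_def by blast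
  define e :: "'a \<Rightarrow> 'a fract" where "e = (\<lambda>a. Fraction_Field.Fract a 1)"
  have e_mult: "e (u * v) = e u * e v" and e_minus: "e (- u) = - e u" for u v
    by (auto simp: e_def)
  have e_sum: "e (\<Sum>i\<in>S. f i) = (\<Sum>i\<in>S. e (f i))" for S and f :: "nat \<Rightarrow> 'a"
    by (simp add: e_def sum_Fract_1)
  have e_pow: "e (u ^ k) = e u ^ k" for u k by (simp add: e_def power_Fract_1)
  have e0: "e u = 0 \<longleftrightarrow> u = 0" and e1: "e 1 = 1" for u
    by (auto simp: e_def Fraction_Field.Zero_fract_def Fraction_Field.One_fract_def Fraction_Field.eq_fract)
  define x where "x = Fraction_Field.Fract a b"
  have bx: "e b * x = e a" using b by (simp add: e_def x_def Fraction_Field.eq_fract)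
  have yx: "e (y k) = x ^ k * e d" for k
  proof -
    have "e b ^ k * e (y k) = (e b * x) ^ k * e d"
      using arg_cong[OF y[of k], of e] by (simp add: e_mult e_pow bx)
    then have "e b ^ k * e (y k) = e b ^ k * (x ^ k * e d)" by (simp add: power_mult_distrib mult.assoc)
    moreover have "e b ^ k \<noteq> 0" using b e0 by simp
    ultimately show ?thesis by (metis mult_left_cancel)
  qed
  have "x ^ Suc N * e d = (\<Sum>k\<le>N. e (c k) * x ^ k) * e d"
    using arg_cong[OF c, of e] by (simp only: e_sum e_mult yx sum_distrib_right mult.assoc)
  then have xN: "x ^ Suc N = (\<Sum>k\<le>N. e (c k) * x ^ k)" using d(2) e0 by simp
  define q where "q = Polynomial.monom 1 (Suc N) - (\<Sum>k\<le>N. Polynomial.monom (c k) k)"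
  have coeff_q: "Polynomial.coeff q i = (if i = Suc N then 1 else if i \<le> N then - c i else 0)" for i
    by (simp add: q_def Polynomial.coeff_sum)
  have deg: "Polynomial.degree q = Suc N"
    by (rule antisym, rule degree_le, simp add: coeff_q, rule le_degree, simp add: coeff_q)
  have "poly (map_poly e q) x = (\<Sum>i\<le>Suc N. Polynomial.coeff (map_poly e q) i * x ^ i)"
    by (rule degree_bounded_poly_eq_sum, rule degree_le) (auto simp: coeff_map_poly e0 coeff_q)
  also have "\<dots> = (\<Sum>i\<le>Suc N. e (Polynomial.coeff q i) * x ^ i)"
    by (simp add: coeff_map_poly e0)
  also have "\<dots> = (\<Sum>k\<le>N. - (e (c k) * x ^ k)) + x ^ Suc N"
    by (simp add: coeff_q e_minus e1)
  also have "\<dots> = 0" unfolding xN by (simp add: sum_negf)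
  finally have "poly (map_poly (\<lambda>a. Fraction_Field.Fract a 1) q) x = 0" by (simp add: e_def)
  moreover have "lead_coeff q = 1" by (simp add: deg coeff_q)
  ultimately have "x \<in> range e"
    using integrally_closed unfolding integrally_closed_def e_def by blast
  then obtain r where "x = e r" by blast
  then have "e a = e (b * r)" using bx by (simp add: e_mult)
  then have "a = b * r" by (simp add: e_def Fraction_Field.eq_fract)
  then show ?thesis by simp
qed

text \<open>Among the conductors \<open>(a : y)\<close> contained in \<open>P\<close>, with \<open>a\<close> not dividing \<open>y\<close>, a maximal one is a
  prime ideal, hence equal to \<open>P\<close>.\<close>

lemma maximal_ideal_is_conductor:
  assumes P: "r_maximal_ideal P" and a: "(a :: 'a) \<in> P" "a \<noteq> 0"
  shows "\<exists>y. \<not> a dvd y \<and> (\<forall>t\<in>P. a dvd y * t)"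
proof -
  have PI: "r_ideal P" "1 \<notin> P" using P r_ideal_eq_UNIV_iff by (auto simp: r_maximal_ideal_def)
  have Pp: "r_prime_ideal P" using P by (rule r_maximal_imp_prime)
  define C where "C y = {t. a dvd y * t}" for y
  have C_ideal: "r_ideal (C y)" for y
    by (auto simp: C_def r_ideal_def distrib_left mult.left_commute)
  let ?Y = "{y. \<not> a dvd y \<and> C y \<subseteq> P}"
  have "\<not> a dvd 1" using a(1) PI by (metis dvdE mult.commute r_ideal_mult)
  moreover have "C 1 \<subseteq> P" using a(1) PI by (auto simp: C_def dvd_def intro: r_ideal_mult_right)
  ultimately have "1 \<in> ?Y" by simp
  then obtain y where y': "y \<in> ?Y" and max': "\<And>z. z \<in> ?Y \<Longrightarrow> C y \<subseteq> C z \<Longrightarrow> C z = C y"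
    by (rule maximal_ideal_in_familyE[of "\<lambda>y. y \<in> ?Y" 1 C]) (rule C_ideal, blast)
  have y: "\<not> a dvd y" "C y \<subseteq> P" using y' by simp_all
  have max: "C z = C y" if "\<not> a dvd z" "C z \<subseteq> P" "C y \<subseteq> C z" for z
    by (rule max') (use that in simp_all)
  have le: "C y \<subseteq> C (y * w)" for w by (auto simp: C_def mult.assoc mult.left_commute)
  \<comment> \<open>Elements outside \<open>P\<close> can be cancelled: multiplying \<open>y\<close>
    by such a \<open>w\<close> keeps the conductor inside the prime ideal \<open>P\<close>, so by
    maximality the conductor does not grow.\<close>
  have unit: "x \<in> C y" if xw: "x * w \<in> C y" and w: "w \<notin> P" for x w
  proof -
    have "C (y * w) \<subseteq> P"
    proof
      fix t assume "t \<in> C (y * w)"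
      then have "w * t \<in> P" using y(2) by (auto simp: C_def mult.assoc)
      then show "t \<in> P" using r_prime_idealD[OF Pp] w by blast
    qed
    moreover have "\<not> a dvd y * w" using w y(2) by (auto simp: C_def)
    ultimately have "C (y * w) = C y" by (intro max le)
    moreover have "x \<in> C (y * w)" using xw by (simp add: C_def ac_simps)
    ultimately show ?thesis by simp
  qed
  have "r_prime_ideal (C y)"
    unfolding r_prime_ideal_def
  proof (intro conjI allI impI C_ideal)
    show "C y \<noteq> UNIV" using y(2) PI(2) by blast
    fix u v assume uv: "u * v \<in> C y"
    show "u \<in> C y \<or> v \<in> C y"
    proof (rule ccontr)
      assume n: "\<not> (u \<in> C y \<or> v \<in> C y)"
      then have "\<not> a dvd y * u" by (simp add: C_def)
      moreover have "v \<in> C (y * u)" using uv by (simp add: C_def mult.assoc)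
      \<comment> \<open>The conductor of \<open>y * u\<close> contains \<open>v\<close> and so is
        strictly larger than \<open>C y\<close>. By maximality it leaves \<open>P\<close>, and an
        element \<open>s\<close> outside \<open>P\<close> with \<open>u * s\<close> in
        \<open>C y\<close> can be cancelled by \<open>unit\<close>.\<close>
      ultimately have "\<not> C (y * u) \<subseteq> P" using max[of "y * u", OF _ _ le] n by auto
      then obtain s where "s \<notin> P" "s \<in> C (y * u)" by blast
      then have "u \<in> C y" using unit[of u s] by (simp add: C_def mult.assoc)
      then show False using n by blast
    qed
  qed
  moreover have "C y \<noteq> {0}"
  proof -
    have "a \<in> C y" by (simp add: C_def)
    then show ?thesis using a(2) by blast
  qed
  ultimately have "r_maximal_ideal (C y)" by (rule prime_imp_maximal)
  then have "C y = P" using y(2) P by (auto simp: r_maximal_ideal_def)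
  then show ?thesis using y(1) unfolding C_def by blast
qed

text \<open>The second factor B is c I^{-1}, so the claim amounts to I I^{-1} = R. If it fails, the
  ideal Q with cQ = IB lies in a maximal ideal P, which contains c. The conductor lemma gives y with
  yP inside (c) but y not in (c). Then y / c maps the nonzero ideal B into itself, and integral
  closedness forces c to divide y.\<close>

lemma ideal_invertible:
  assumes I: "r_ideal (I :: 'a set)" and c: "c \<in> I" "c \<noteq> 0"
  shows "c \<in> ideal_prod I {b. \<forall>t\<in>I. c dvd b * t}"
proof (rule ccontr)
  define B where "B = {b. \<forall>t\<in>I. c dvd b * t}"
  assume "c \<notin> ideal_prod I {b. \<forall>t\<in>I. c dvd b * t}"
  then have neg: "c \<notin> ideal_prod I B" by (simp add: B_def)
  define Q where "Q = {q. c * q \<in> ideal_prod I B}"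
  have B: "r_ideal B" unfolding B_def by (auto simp: r_ideal_def distrib_right mult.assoc)
  have "r_ideal Q"
    unfolding Q_def using r_ideal_ideal_prod[of I B]
    by (auto simp: r_ideal_def distrib_left mult.left_commute)
  moreover have "1 \<notin> Q" using neg by (simp add: Q_def)
  ultimately obtain P where P: "r_maximal_ideal P" "Q \<subseteq> P" using exists_maximal_ideal by blast
  have cB: "c \<in> B" by (simp add: B_def)
  have "c \<in> Q" using ideal_prod_memI[OF c(1) cB] by (simp add: Q_def)
  then have "c \<in> P" using P by blast
  then obtain y where y: "\<not> c dvd y" "\<And>t. t \<in> P \<Longrightarrow> c dvd y * t"
    using maximal_ideal_is_conductor[OF P(1) _ c(2)] by blast
  have "\<exists>s\<in>B. y * b = c * s" if b: "b \<in> B" for b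
  proof -
    \<comment> \<open>The quotient of \<open>b * t\<close> by \<open>c\<close> lies in
      \<open>Q\<close> and hence in \<open>P\<close>, so \<open>y\<close> times it is again
      divisible by \<open>c\<close>. Taking \<open>t = c\<close> shows that \<open>c\<close> divides
      \<open>y * b\<close>, and a general \<open>t\<close> puts the quotient back into
      \<open>B\<close>.\<close>
    have key: "c * c dvd y * (t * b)" if t: "t \<in> I" for t
    proof -
      obtain q where q: "b * t = c * q" using t b by (auto simp: B_def)
      have "c * q \<in> ideal_prod I B" using ideal_prod_memI[OF t b] q by (simp add: mult.commute)
      then have "q \<in> P" using P(2) by (auto simp: Q_def)
      then have "c dvd y * q" by (rule y)
      then have "c * c dvd c * (y * q)" by (rule mult_dvd_mono[OF dvd_refl])
      moreover have "c * (y * q) = y * (t * b)" using q by (simp add: ac_simps)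
      ultimately show ?thesis by simp
    qed
    have "c * c dvd c * (y * b)" using key[OF c(1)] by (simp add: ac_simps)
    then have "c dvd y * b" using c(2) by simp
    then obtain s where s: "y * b = c * s" by (auto simp: dvd_def)
    have "c dvd s * t" if t: "t \<in> I" for t
    proof -
      have "c * c dvd c * (s * t)"
        using key[OF t] s by (metis mult.assoc mult.commute)
      then show ?thesis using c(2) by simp
    qed
    then have "s \<in> B" by (simp add: B_def)
    then show ?thesis using s by blast
  qed
  moreover have "B \<noteq> {0}" using cB c(2) by auto
  ultimately have "c dvd y" using dvd_if_scaled_ideal_subset[OF B _ c(2)] by blast
  then show False using y(1) by blast
qed

text \<open>Noetherian induction: a maximal counterexample M is neither the whole ring nor prime,
  since a nonzero prime has only itself above it. So M contains some uv with neither factor in M. A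
  maximal ideal above M contains u or v, hence one of the strictly larger ideals M + (u) and M +
  (v), which have only finitely many maximal ideals above them.\<close>

lemma finite_maximal_ideals_above:
  assumes "r_ideal (J :: 'a set)" "J \<noteq> {0}"
  shows "finite {P. r_maximal_ideal P \<and> J \<subseteq> P}"
proof (rule ccontr)
  let ?S = "\<lambda>J. {P. r_maximal_ideal P \<and> J \<subseteq> P}"
  let ?F = "{J :: 'a set. r_ideal J \<and> J \<noteq> {0} \<and> infinite (?S J)}"
  assume "infinite (?S J)"
  then have "J \<in> ?F" using assms by blast
  then obtain M where M': "M \<in> ?F" and max': "\<And>J. J \<in> ?F \<Longrightarrow> M \<subseteq> J \<Longrightarrow> J = M"
    by (rule maximal_ideal_in_familyE[of "\<lambda>J. J \<in> ?F" J "\<lambda>J. J"]) (simp, blast)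
  have M: "r_ideal M" "M \<noteq> {0}" "infinite (?S M)" using M' by simp_all
  have max: "J = M" if "r_ideal J" "J \<noteq> {0}" "infinite (?S J)" "M \<subseteq> J" for J
    by (rule max') (use that in simp_all)
  have "M \<noteq> UNIV"
  proof
    assume "M = UNIV"
    then have "?S M = {}" by (auto simp: r_maximal_ideal_def)
    then show False using M(3) by (metis finite.emptyI)
  qed
  have "\<not> r_prime_ideal M"
  proof
    assume "r_prime_ideal M"
    then have "r_maximal_ideal M" using M(2) prime_imp_maximal by blast
    then have "?S M \<subseteq> {M}" by (auto simp: r_maximal_ideal_def)
    then show False using M(3) finite_subset by blast
  qed
  then obtain u v where uv: "u * v \<in> M" "u \<notin> M" "v \<notin> M"
    using M(1) \<open>M \<noteq> UNIV\<close> by (auto simp: r_prime_ideal_def)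
  have fin: "finite (?S (ideal_sum M {x. w dvd x}))" if "w \<notin> M" for w
  proof (rule ccontr)
    let ?J = "ideal_sum M {x. w dvd x}"
    assume inf: "infinite (?S ?J)"
    have J: "r_ideal ?J" "M \<subseteq> ?J" "w \<in> ?J"
      using r_ideal_ideal_sum[OF M(1) r_ideal_principal] ideal_sum_upper[OF M(1) r_ideal_principal[of w]]
      by auto
    moreover have "?J \<noteq> {0}" using J(2) M(1,2) r_ideal_zero by blast
    ultimately have "?J = M" using max inf by blast
    then show False using J(3) that by blast
  qed
  have "?S M \<subseteq> ?S (ideal_sum M {x. u dvd x}) \<union> ?S (ideal_sum M {x. v dvd x})"
  proof
    fix P assume "P \<in> ?S M"
    then have P: "r_maximal_ideal P" "M \<subseteq> P" "r_ideal P" by (auto simp: r_maximal_ideal_def)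
    have "u \<in> P \<or> v \<in> P" using r_prime_idealD[OF r_maximal_imp_prime[OF P(1)]] uv(1) P(2) by blast
    then show "P \<in> ?S (ideal_sum M {x. u dvd x}) \<union> ?S (ideal_sum M {x. v dvd x})"
      using P by (fastforce simp: ideal_sum_def dvd_def intro!: r_ideal_add r_ideal_mult_right)
  qed
  then show False using M(3) fin uv(2,3) by (meson finite_UnI finite_subset)
qed

text \<open>Distinct maximal ideals are incomparable, so each \<open>Q\<close> in \<open>F\<close>
  has an element outside \<open>P\<close>; the product of these elements stays outside the prime
  ideal \<open>P\<close>.\<close>

lemma exists_in_all_but_one_maximal:
  assumes "finite F" "r_maximal_ideal P" "P \<notin> F" "\<And>Q. Q \<in> F \<Longrightarrow> r_maximal_ideal Q"
  shows "\<exists>y. y \<notin> P \<and> (\<forall>Q\<in>F. (y :: 'a) \<in> Q)"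
  using assms
proof (induction F rule: finite_induct)
  case empty
  then show ?case by (auto simp: r_maximal_ideal_def)
next
  case (insert Q F)
  then obtain y where y: "y \<notin> P" "\<forall>Q\<in>F. y \<in> Q" by blast
  have Q: "r_maximal_ideal Q" "Q \<noteq> P" using insert by auto
  then have "\<not> Q \<subseteq> P" using insert.prems(1) unfolding r_maximal_ideal_def by blast
  then obtain z where z: "z \<in> Q" "z \<notin> P" by blast
  have "y * z \<notin> P" using y z r_prime_idealD r_maximal_imp_prime insert.prems(1) by blast
  moreover have "y * z \<in> Q'" if "Q' \<in> insert Q F" for Q'
    using that y z insert.prems(3)[of Q'] by (auto simp: r_maximal_ideal_def intro: r_ideal_mult r_ideal_mult_right)
  ultimately show ?case by blast
qed

end

subsection \<open>Nonzero ideals and their classes\<close>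

text \<open>As a type, the nonzero ideals form an instance of \<open>comm_monoid_mult\<close>, which
  provides powers and products over lists and finite sets. Being nonzero is preserved under products
  because the ring is a domain.\<close>

typedef (overloaded) 'a nzideal = "{I :: 'a::idom set. r_ideal I \<and> I \<noteq> {0}}"
  morphisms iset Abs_nzideal
proof -
  have "(1::'a) \<in> UNIV" "(1::'a) \<notin> {0}" by auto
  then show ?thesis using r_ideal_UNIV by blast
qed

lemma r_ideal_iset [simp]: "r_ideal (iset I)"
  and iset_nonzero: "iset I \<noteq> {0}"
  using iset[of I] by auto

lemma nzideal_eqI: "iset I = iset J \<Longrightarrow> I = J"
  by (simp add: iset_inject)

lemma iset_zero [simp]: "0 \<in> iset I"
  by (rule r_ideal_zero) simp

lemma iset_nonzeroE: obtains c where "c \<in> iset I" "c \<noteq> 0"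
  using iset_nonzero[of I] iset_zero[of I] by blast

instantiation nzideal :: (idom) comm_monoid_mult
begin

definition "I * J = Abs_nzideal (ideal_prod (iset I) (iset J))"
definition "1 = Abs_nzideal UNIV"

lemma iset_times: "iset (I * J) = ideal_prod (iset I) (iset J)"
proof -
  obtain a b where "a \<in> iset I" "a \<noteq> 0" "b \<in> iset J" "b \<noteq> 0"
    by (metis iset_nonzeroE)
  then have "a * b \<in> ideal_prod (iset I) (iset J)" "a * b \<noteq> 0" by (auto intro: ideal_prod_memI)
  then have "ideal_prod (iset I) (iset J) \<in> {I. r_ideal I \<and> I \<noteq> {0}}"
    using r_ideal_ideal_prod by blast
  then show ?thesis unfolding times_nzideal_def by (rule Abs_nzideal_inverse)
qed

lemma iset_one: "iset (1 :: 'a nzideal) = UNIV"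
proof -
  have "(1::'a) \<in> UNIV" "(1::'a) \<notin> {0}" by auto
  then have "(UNIV :: 'a set) \<in> {I. r_ideal I \<and> I \<noteq> {0}}"
    using r_ideal_UNIV by blast
  then show ?thesis unfolding one_nzideal_def by (rule Abs_nzideal_inverse)
qed

instance
proof
  fix I J K :: "'a nzideal"
  show "I * J * K = I * (J * K)"
    by (rule nzideal_eqI) (simp add: iset_times ideal_prod_assoc)
  show "I * J = J * I"
    by (rule nzideal_eqI) (simp add: iset_times ideal_prod_commute)
  show "1 * I = I"
    by (rule nzideal_eqI) (simp add: iset_times iset_one ideal_prod_UNIV)
qed

end

text \<open>For \<open>a = 0\<close> the set is the zero ideal, which the type excludes; the value
  is then unspecified, and the lemmas assume \<open>a \<noteq> 0\<close>.\<close>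

definition principal_nzideal :: "'a::idom \<Rightarrow> 'a nzideal" where
  "principal_nzideal a = Abs_nzideal {x. a dvd x}"

lemma iset_principal: "a \<noteq> 0 \<Longrightarrow> iset (principal_nzideal a) = {x. a dvd x}"
proof -
  assume "a \<noteq> 0"
  moreover have "a \<in> {x. a dvd x}" by simp
  ultimately have "{x. a dvd x} \<noteq> {0}" by blast
  then show ?thesis
    unfolding principal_nzideal_def by (intro Abs_nzideal_inverse) (simp add: r_ideal_principal)
qed

lemma iset_principal_times:
  assumes "a \<noteq> 0"
  shows "iset (principal_nzideal a * I) = (*) a ` iset I"
proof
  have "r_ideal ((*) a ` iset I)"
  proof (rule r_idealI)
    show "0 \<in> (*) a ` iset I" by (rule image_eqI[of _ _ 0]) simp_all
  next
    fix x y assume "x \<in> (*) a ` iset I" "y \<in> (*) a ` iset I"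
    then obtain s t where "x + y = a * (s + t)" "s \<in> iset I" "t \<in> iset I"
      by (auto simp: distrib_left)
    then show "x + y \<in> (*) a ` iset I" using r_ideal_add[OF r_ideal_iset] by blast
  next
    fix r x assume "x \<in> (*) a ` iset I"
    then obtain s where "r * x = a * (r * s)" "s \<in> iset I" by (auto simp: ac_simps)
    then show "r * x \<in> (*) a ` iset I" using r_ideal_mult[OF r_ideal_iset] by blast
  qed
  then show "iset (principal_nzideal a * I) \<subseteq> (*) a ` iset I"
    unfolding iset_times iset_principal[OF assms]
    by (rule ideal_prod_least) (auto simp: dvd_def mult.assoc intro!: imageI r_ideal_mult[OF r_ideal_iset])
  show "(*) a ` iset I \<subseteq> iset (principal_nzideal a * I)"
    unfolding iset_times iset_principal[OF assms] by (auto intro: ideal_prod_memI)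
qed

lemma principal_one: "principal_nzideal 1 = 1"
  by (rule nzideal_eqI) (simp add: iset_principal iset_one)

lemma principal_times:
  assumes "a \<noteq> 0" "b \<noteq> 0"
  shows "principal_nzideal a * principal_nzideal b = principal_nzideal (a * b)"
  by (rule nzideal_eqI)
    (use assms in \<open>auto simp: iset_principal_times iset_principal dvd_def mult.assoc image_iff\<close>)

text \<open>This is the relation I = (b / a) J of fractional ideals with denominators
  cleared.\<close>

definition ideal_equiv :: "'a::idom nzideal \<Rightarrow> 'a nzideal \<Rightarrow> bool" where
  "ideal_equiv I J \<longleftrightarrow> (\<exists>a b. a \<noteq> 0 \<and> b \<noteq> 0 \<and> principal_nzideal a * I = principal_nzideal b * J)"

lemma ideal_equivI: "a \<noteq> 0 \<Longrightarrow> b \<noteq> 0 \<Longrightarrow> principal_nzideal a * I = principal_nzideal b * J \<Longrightarrow> ideal_equiv I J"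
  unfolding ideal_equiv_def by blast

lemma ideal_equiv_refl [simp]: "ideal_equiv I I"
  using ideal_equivI[of 1 1 I I] by simp

lemma ideal_equiv_sym: "ideal_equiv I J \<Longrightarrow> ideal_equiv J I"
  unfolding ideal_equiv_def by metis

lemma ideal_equiv_trans:
  assumes "ideal_equiv I J" "ideal_equiv J K"
  shows "ideal_equiv I K"
proof -
  obtain a b c d where nz: "a \<noteq> 0" "b \<noteq> 0" "c \<noteq> 0" "d \<noteq> 0"
    and *: "principal_nzideal a * I = principal_nzideal b * J" "principal_nzideal c * J = principal_nzideal d * K"
    using assms unfolding ideal_equiv_def by blast
  have "principal_nzideal (c * a) * I = principal_nzideal c * (principal_nzideal b * J)"
    using nz by (simp add: * mult.assoc flip: principal_times)
  also have "\<dots> = principal_nzideal (b * d) * K"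
    using nz * by (simp add: mult.assoc mult.left_commute flip: principal_times)
  finally show ?thesis using nz by (intro ideal_equivI) auto
qed

lemma ideal_equiv_mult:
  assumes "ideal_equiv I J" "ideal_equiv I' J'"
  shows "ideal_equiv (I * I') (J * J')"
proof -
  obtain a b c d where nz: "a \<noteq> 0" "b \<noteq> 0" "c \<noteq> 0" "d \<noteq> 0"
    and *: "principal_nzideal a * I = principal_nzideal b * J" "principal_nzideal c * I' = principal_nzideal d * J'"
    using assms unfolding ideal_equiv_def by blast
  have "principal_nzideal (a * c) * (I * I') = (principal_nzideal a * I) * (principal_nzideal c * I')"
    using nz by (simp add: ac_simps flip: principal_times)
  also have "\<dots> = principal_nzideal (b * d) * (J * J')"
    unfolding * using nz by (simp add: ac_simps flip: principal_times)
  finally show ?thesis using nz by (intro ideal_equivI) auto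
qed

lemma ideal_equiv_principal: "a \<noteq> 0 \<Longrightarrow> ideal_equiv (principal_nzideal a) 1"
  by (rule ideal_equivI[of 1 a]) (simp_all add: principal_one)

section \<open>Inverse classes and coprime representatives\<close>

context dedekind
begin

text \<open>The ideal \<open>B\<close> is c I^{-1}. That \<open>I * B\<close> lies in (c) is built
  into the conductor; the other inclusion is \<open>ideal_invertible\<close>. Since (c) is trivial
  in the class monoid, every class gets an inverse.\<close>

lemma conductor_ideal:
  assumes "c \<in> iset I" "c \<noteq> 0"
  shows "\<exists>B. iset B = {b. \<forall>t\<in>iset I. c dvd b * t} \<and> I * B = principal_nzideal (c::'a)"
proof -
  let ?B = "{b. \<forall>t\<in>iset I. c dvd b * t}"
  have "c \<in> ?B" by simp
  then have "?B \<noteq> {0}" using assms(2) by blast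
  moreover have "r_ideal ?B" by (auto simp: r_ideal_def distrib_right mult.assoc)
  ultimately have B: "iset (Abs_nzideal ?B) = ?B" by (intro Abs_nzideal_inverse) simp
  have "I * Abs_nzideal ?B = principal_nzideal c"
  proof (rule nzideal_eqI, unfold iset_times B iset_principal[OF assms(2)], rule antisym)
    show "ideal_prod (iset I) ?B \<subseteq> {x. c dvd x}"
      by (rule ideal_prod_least[OF r_ideal_principal]) (auto simp: mult.commute)
    have "c \<in> ideal_prod (iset I) ?B" using assms by (intro ideal_invertible) auto
    then show "{x. c dvd x} \<subseteq> ideal_prod (iset I) ?B"
      by (auto simp: dvd_def intro: r_ideal_mult_right r_ideal_ideal_prod)
  qed
  then show ?thesis using B by blast
qed

lemma ideal_equiv_inverse: "\<exists>J. ideal_equiv (I * J) (1 :: 'a nzideal)"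
  by (metis iset_nonzeroE conductor_ideal ideal_equiv_principal)

lemma ideal_equiv_cancel:
  assumes "ideal_equiv (I * K) (J * K)"
  shows "ideal_equiv I (J :: 'a nzideal)"
proof -
  obtain L where L: "ideal_equiv (K * L) 1" using ideal_equiv_inverse by blast
  have "ideal_equiv (I * (K * L)) (J * (K * L))"
    using ideal_equiv_mult[OF assms ideal_equiv_refl[of L]] by (simp add: mult.assoc)
  moreover have "ideal_equiv (X * (K * L)) X" for X
    using ideal_equiv_mult[OF ideal_equiv_refl[of X] L] by simp
  ultimately show ?thesis by (meson ideal_equiv_sym ideal_equiv_trans)
qed

text \<open>Multiplying \<open>I\<close> by \<open>x / c\<close> makes it coprime to every ideal in \<open>F\<close>.\<close>

lemma exists_multiplier_avoiding_maximal:
  assumes c: "c \<in> iset I" "c \<noteq> (0::'a)"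
    and F: "finite F" "\<And>P. P \<in> F \<Longrightarrow> r_maximal_ideal P"
  shows "\<exists>x. (\<forall>t\<in>iset I. c dvd x * t) \<and> (\<forall>P\<in>F. \<exists>t\<in>iset I. \<exists>q. x * t = c * q \<and> q \<notin> P)"
  using F
proof (induction F rule: finite_induct)
  case empty
  have "\<forall>t\<in>iset I. c dvd 0 * t" by simp
  then show ?case by blast
next
  case (insert P F)
  define big where "big x P \<longleftrightarrow> (\<exists>t\<in>iset I. \<exists>q. x * t = c * q \<and> q \<notin> P)" for x P
  obtain x where x: "\<forall>t\<in>iset I. c dvd x * t" and xF: "\<forall>Q\<in>F. big x Q"
    using insert unfolding big_def by auto
  have P: "r_maximal_ideal P" using insert by simp
  have Pp: "r_prime_ideal P" using r_maximal_imp_prime[OF P] .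
  have PI: "r_ideal P" using P by (simp add: r_maximal_ideal_def)
  show ?case
  proof (cases "big x P")
    case True
    then show ?thesis using x xF unfolding big_def by blast
  next
    case False
    then have xP: "q \<in> P" if "t \<in> iset I" "x * t = c * q" for t q
      using that unfolding big_def by blast
    obtain y where y: "y \<notin> P" "\<forall>Q\<in>F. y \<in> Q"
      using exists_in_all_but_one_maximal[of F P] insert by auto
    \<comment> \<open>Otherwise the product of \<open>I\<close> with its conductor would lie in c P,
      and invertibility, which puts \<open>c\<close> into that product, would give 1 in
      \<open>P\<close>.\<close>
    have "\<exists>b. (\<forall>t\<in>iset I. c dvd b * t) \<and> big b P"
    proof (rule ccontr)
      assume neg: "\<nexists>b. (\<forall>t\<in>iset I. c dvd b * t) \<and> big b P"
      have "r_ideal ((*) c ` P)"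
      proof (rule r_idealI)
        show "0 \<in> (*) c ` P" by (rule image_eqI[of _ _ 0]) (simp_all add: r_ideal_zero PI)
      next
        fix x y assume "x \<in> (*) c ` P" "y \<in> (*) c ` P"
        then obtain s t where "x + y = c * (s + t)" "s \<in> P" "t \<in> P" by (auto simp: distrib_left)
        then show "x + y \<in> (*) c ` P" using r_ideal_add[OF PI] by blast
      next
        fix r x assume "x \<in> (*) c ` P"
        then obtain s where "r * x = c * (r * s)" "s \<in> P" by (auto simp: ac_simps)
        then show "r * x \<in> (*) c ` P" using r_ideal_mult[OF PI] by blast
      qed
      then have "ideal_prod (iset I) {b. \<forall>t\<in>iset I. c dvd b * t} \<subseteq> (*) c ` P"
      proof (rule ideal_prod_least)
        fix t b assume t: "t \<in> iset I" and b: "b \<in> {b. \<forall>t\<in>iset I. c dvd b * t}"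
        then obtain q where q: "b * t = c * q" by (auto simp: dvd_def)
        have "\<not> big b P" using neg b by blast
        then have "q \<in> P" using q t unfolding big_def by blast
        then show "t * b \<in> (*) c ` P" using q by (auto simp: mult.commute)
      qed
      then have "c \<in> (*) c ` P" using ideal_invertible[OF r_ideal_iset c] by blast
      then have "1 \<in> P" using c(2) by auto
      then show False using P r_ideal_eq_UNIV_iff[OF PI] by (simp add: r_maximal_ideal_def)
    qed
    then obtain b where b: "\<forall>t\<in>iset I. c dvd b * t" "big b P" by blast
    \<comment> \<open>The correction \<open>y * b\<close> vanishes modulo every \<open>Q\<close> in
      \<open>F\<close>, since \<open>y\<close> lies in \<open>Q\<close>, so what holds there for
      \<open>x\<close> is kept. Modulo \<open>P\<close> the part from \<open>x\<close> vanishes,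
      while that from \<open>b\<close> survives because \<open>y\<close> is outside
      \<open>P\<close>.\<close>
    define x' where "x' = x + y * b"
    have split: "\<exists>q q'. x * t = c * q \<and> b * t = c * q' \<and> x' * t = c * (q + y * q')"
      if t: "t \<in> iset I" for t
    proof -
      obtain q q' where "x * t = c * q" "b * t = c * q'"
        using bspec[OF x t] bspec[OF b(1) t] by (elim dvdE)
      then show ?thesis by (intro exI[of _ q] exI[of _ q']) (simp add: x'_def algebra_simps)
    qed
    have "\<forall>t\<in>iset I. c dvd x' * t" using split by force
    moreover have "big x' P"
    proof -
      obtain t q0 where t: "t \<in> iset I" "b * t = c * q0" "q0 \<notin> P" using b(2) unfolding big_def by blast
      obtain q q' where q: "x * t = c * q" "b * t = c * q'" "x' * t = c * (q + y * q')"
        using split[OF t(1)] by blast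
      have "q' = q0" using q(2) t(2) c(2) by simp
      then have "y * q' \<notin> P" using y(1) t(3) r_prime_idealD[OF Pp] by blast
      moreover have "q \<in> P" using xP t(1) q(1) by blast
      ultimately have "q + y * q' \<notin> P" using r_ideal_diff[OF PI, of "q + y * q'" q] by auto
      then show ?thesis using q(3) t(1) unfolding big_def by blast
    qed
    moreover have "big x' Q" if Q: "Q \<in> F" for Q
    proof -
      have QI: "r_ideal Q" using insert.prems[of Q] Q by (simp add: r_maximal_ideal_def)
      obtain t q0 where t: "t \<in> iset I" "x * t = c * q0" "q0 \<notin> Q" using xF Q unfolding big_def by blast
      obtain q q' where q: "x * t = c * q" "b * t = c * q'" "x' * t = c * (q + y * q')"
        using split[OF t(1)] by blast
      have "q = q0" using q(1) t(2) c(2) by simp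
      moreover have "y * q' \<in> Q" using y(2) Q QI by (auto intro: r_ideal_mult_right)
      ultimately have "q + y * q' \<notin> Q" using t(3) r_ideal_diff[OF QI, of "q + y * q'" "y * q'"] by auto
      then show ?thesis using q(3) t(1) unfolding big_def by blast
    qed
    ultimately show ?thesis unfolding big_def by (intro exI[of _ x']) blast
  qed
qed

text \<open>Only finitely many maximal ideals contain \<open>J\<close>, so one multiplier x / c
  deals with all of them. The ideal (x / c) I is contained in none of these, hence its sum with
  \<open>J\<close> lies in no maximal ideal at all.\<close>

lemma coprime_representative:
  fixes I J :: "'a nzideal"
  shows "\<exists>I'. ideal_equiv I I' \<and> (\<exists>u\<in>iset I'. \<exists>v\<in>iset J. u + v = 1)"
proof (cases "1 \<in> iset J")
  case True
  have "0 + 1 = (1::'a)" by simp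
  then show ?thesis using True ideal_equiv_refl iset_zero by blast
next
  case False
  let ?F = "{P. r_maximal_ideal P \<and> iset J \<subseteq> P}"
  have fin: "finite ?F" by (rule finite_maximal_ideals_above[OF r_ideal_iset iset_nonzero])
  \<comment> \<open>A maximal ideal above \<open>J\<close> is what forces
    \<open>Q \<noteq> {0}\<close>: an empty \<open>?F\<close> would allow \<open>x = 0\<close>. This
    is why the case of the unit ideal is treated separately.\<close>
  obtain P0 where P0: "P0 \<in> ?F" using exists_maximal_ideal[OF r_ideal_iset False] by blast
  obtain c where c: "c \<in> iset I" "c \<noteq> 0" by (rule iset_nonzeroE)
  obtain x where x: "\<forall>t\<in>iset I. c dvd x * t" "\<forall>P\<in>?F. \<exists>t\<in>iset I. \<exists>q. x * t = c * q \<and> q \<notin> P"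
    using exists_multiplier_avoiding_maximal[OF c fin] by blast
  define Q where "Q = {q. \<exists>t\<in>iset I. c * q = x * t}"
  have Q: "r_ideal Q"
  proof (rule r_idealI)
    show "0 \<in> Q" unfolding Q_def using iset_zero[of I] by force
  next
    fix q q' assume "q \<in> Q" "q' \<in> Q"
    then obtain t t' where "t \<in> iset I" "t' \<in> iset I" "c * q = x * t" "c * q' = x * t'"
      unfolding Q_def by blast
    then have "t + t' \<in> iset I" "c * (q + q') = x * (t + t')"
      by (auto simp: distrib_left intro: r_ideal_add)
    then show "q + q' \<in> Q" unfolding Q_def by blast
  next
    fix r q assume "q \<in> Q"
    then obtain t where "t \<in> iset I" "c * q = x * t" unfolding Q_def by blast
    then have "r * t \<in> iset I" "c * (r * q) = x * (r * t)"
      by (auto simp: mult.left_commute intro: r_ideal_mult)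
    then show "r * q \<in> Q" unfolding Q_def by blast
  qed
  have notsub: "\<not> Q \<subseteq> P" if P: "P \<in> ?F" for P
  proof -
    obtain t q where "t \<in> iset I" "x * t = c * q" "q \<notin> P" using bspec[OF x(2) P] by (elim bexE exE conjE)
    then have "q \<in> Q" "q \<notin> P" unfolding Q_def by (metis (mono_tags, lifting) mem_Collect_eq)+
    then show ?thesis by blast
  qed
  have "0 \<in> P0" using P0 by (auto simp: r_maximal_ideal_def intro: r_ideal_zero)
  then have "Q \<noteq> {0}" using notsub[OF P0] by blast
  then have I': "iset (Abs_nzideal Q) = Q" using Q by (intro Abs_nzideal_inverse) simp
  have x0: "x \<noteq> 0"
  proof
    assume "x = 0"
    then have "Q = {0}" using Q r_ideal_zero c(2) by (auto simp: Q_def)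
    then show False using \<open>Q \<noteq> {0}\<close> by blast
  qed
  have "principal_nzideal x * I = principal_nzideal c * Abs_nzideal Q"
  proof (rule nzideal_eqI, unfold iset_principal_times[OF x0] iset_principal_times[OF c(2)] I', rule antisym)
    show "(*) x ` iset I \<subseteq> (*) c ` Q"
    proof
      fix z assume "z \<in> (*) x ` iset I"
      then obtain t where t: "t \<in> iset I" "z = x * t" by blast
      then obtain q where "x * t = c * q" using x(1) by (metis dvdE)
      then have "q \<in> Q" "z = c * q" using t unfolding Q_def by (auto intro: bexI[of _ t])
      then show "z \<in> (*) c ` Q" by blast
    qed
    show "(*) c ` Q \<subseteq> (*) x ` iset I" unfolding Q_def by auto
  qed
  then have eq: "ideal_equiv I (Abs_nzideal Q)" using x0 c(2) by (intro ideal_equivI)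
  have "1 \<in> ideal_sum Q (iset J)"
  proof (rule ccontr)
    assume "1 \<notin> ideal_sum Q (iset J)"
    then obtain P where P: "r_maximal_ideal P" "ideal_sum Q (iset J) \<subseteq> P"
      using exists_maximal_ideal[OF r_ideal_ideal_sum[OF Q r_ideal_iset]] by blast
    then have "P \<in> ?F" "Q \<subseteq> P" using ideal_sum_upper[OF Q r_ideal_iset[of J]] by auto
    then show False using notsub by blast
  qed
  then have "\<exists>u\<in>Q. \<exists>v\<in>iset J. u + v = 1" unfolding ideal_sum_def by force
  then show ?thesis using eq I' by (intro exI[of _ "Abs_nzideal Q"]) simp
qed

end

subsection \<open>Isomorphisms and direct sums of submodules\<close>

lemma vadd_vscale_simps:
  "vadd v w i = v i + w i" "vscale r v i = r * v i"
  by (simp_all add: vadd_def vscale_def)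

lemma submod_zero: "submod M \<Longrightarrow> (\<lambda>_. 0) \<in> M"
  and submod_add: "submod M \<Longrightarrow> v \<in> M \<Longrightarrow> w \<in> M \<Longrightarrow> vadd v w \<in> M"
  and submod_scale: "submod M \<Longrightarrow> v \<in> M \<Longrightarrow> vscale r v \<in> M"
  by (auto simp: submod_def)

lemma submod_diff:
  assumes "submod M" "v \<in> M" "w \<in> M"
  shows "(\<lambda>i. v i - w i) \<in> M"
proof -
  have "(\<lambda>i. v i - w i) = vadd v (vscale (-1) w)" by (auto simp: vadd_vscale_simps)
  then show ?thesis using assms by (auto intro: submod_add submod_scale)
qed

lemma submod_sum:
  assumes "submod M" "\<And>j. j \<in> S \<Longrightarrow> f j \<in> M"
  shows "(\<lambda>i. \<Sum>j\<in>S. f j i) \<in> M"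
  using assms(2)
proof (induction S rule: infinite_finite_induct)
  case (insert x F)
  then have "vadd (f x) (\<lambda>i. \<Sum>j\<in>F. f j i) \<in> M" using assms(1) by (auto intro: submod_add)
  then show ?case using insert by (simp add: vadd_def)
qed (use submod_zero[OF assms(1)] in auto)

lemma submod_free_mod: "submod (free_mod m)"
  by (auto simp: submod_def free_mod_def vadd_def vscale_def)

lemma submod_Int: "submod M \<Longrightarrow> submod N \<Longrightarrow> submod (M \<inter> N)"
  by (auto simp: submod_def)

lemma lin_map_on_add: "lin_map_on M f \<Longrightarrow> v \<in> M \<Longrightarrow> w \<in> M \<Longrightarrow> f (vadd v w) = vadd (f v) (f w)"
  and lin_map_on_scale: "lin_map_on M f \<Longrightarrow> v \<in> M \<Longrightarrow> f (vscale r v) = vscale r (f v)"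
  by (auto simp: lin_map_on_def)

lemma lin_map_on_subset: "lin_map_on M f \<Longrightarrow> N \<subseteq> M \<Longrightarrow> lin_map_on N f"
  unfolding lin_map_on_def by blast

lemma lin_map_on_zero:
  assumes "lin_map_on M f" "submod M"
  shows "f (\<lambda>_. 0) = (\<lambda>_. 0)"
proof -
  have "vscale 0 v = (\<lambda>_. 0)" for v :: "nat \<Rightarrow> 'a" by (simp add: vscale_def)
  then show ?thesis using lin_map_on_scale[OF assms(1) submod_zero[OF assms(2)], of 0] by metis
qed

lemma lin_map_on_sum:
  assumes f: "lin_map_on M f" and M: "submod M" and w: "\<And>j. j \<in> S \<Longrightarrow> w j \<in> M"
  shows "f (\<lambda>i. \<Sum>j\<in>S. c j * w j i) = (\<lambda>i. \<Sum>j\<in>S. c j * f (w j) i)"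
  using w
proof (induction S rule: infinite_finite_induct)
  case (insert x F)
  have "(\<lambda>i. \<Sum>j\<in>F. vscale (c j) (w j) i) \<in> M"
    using insert by (intro submod_sum submod_scale M) auto
  then have F: "(\<lambda>i. \<Sum>j\<in>F. c j * w j i) \<in> M" by (simp add: vscale_def)
  have "(\<lambda>i. \<Sum>j\<in>insert x F. c j * w j i) = vadd (vscale (c x) (w x)) (\<lambda>i. \<Sum>j\<in>F. c j * w j i)"
    using insert.hyps by (simp add: vadd_def vscale_def)
  then have "f (\<lambda>i. \<Sum>j\<in>insert x F. c j * w j i) = vadd (vscale (c x) (f (w x))) (\<lambda>i. \<Sum>j\<in>F. c j * f (w j) i)"
    using insert F f M by (simp add: lin_map_on_add lin_map_on_scale submod_scale)
  then show ?case using insert.hyps by (simp add: vadd_def vscale_def)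
qed (use lin_map_on_zero[OF f M] in auto)

lemma mod_isoI:
  assumes "lin_map_on M f" "\<And>v. v \<in> M \<Longrightarrow> f v \<in> N" "\<And>v. v \<in> M \<Longrightarrow> g (f v) = v"
    "\<And>w. w \<in> N \<Longrightarrow> g w \<in> M" "\<And>w. w \<in> N \<Longrightarrow> f (g w) = w"
  shows "mod_iso M N"
  unfolding mod_iso_def
  by (intro exI[of _ f] conjI assms(1) bij_betwI[of f M N g]) (use assms in auto)

lemma mod_iso_image: "lin_map_on M f \<Longrightarrow> inj_on f M \<Longrightarrow> mod_iso M (f ` M)"
  unfolding mod_iso_def by (auto simp: bij_betw_def)

lemma submod_image:
  assumes "lin_map_on M f" "submod M"
  shows "submod (f ` M)"
  unfolding submod_def
proof (intro conjI ballI allI)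
  show "(\<lambda>_. 0) \<in> f ` M"
    using lin_map_on_zero[OF assms] submod_zero[OF assms(2)] by (metis imageI)
next
  fix v w assume "v \<in> f ` M" "w \<in> f ` M"
  then obtain a b where "v = f a" "w = f b" "a \<in> M" "b \<in> M" by blast
  then have "vadd v w = f (vadd a b)" "vadd a b \<in> M"
    using assms by (auto simp: lin_map_on_add submod_add)
  then show "vadd v w \<in> f ` M" by blast
next
  fix r v assume "v \<in> f ` M"
  then obtain a where "v = f a" "a \<in> M" by blast
  then have "vscale r v = f (vscale r a)" "vscale r a \<in> M"
    using assms by (auto simp: lin_map_on_scale submod_scale)
  then show "vscale r v \<in> f ` M" by blast
qed

lemma submod_mod_iso: "mod_iso M N \<Longrightarrow> submod M \<Longrightarrow> submod N"
  using submod_image unfolding mod_iso_def bij_betw_def by blast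

lemma mod_iso_refl: "mod_iso M M"
  by (rule mod_isoI[of M "\<lambda>x. x" M "\<lambda>x. x"]) (auto simp: lin_map_on_def)

lemma lin_map_on_inv_into:
  assumes f: "lin_map_on M f" "bij_betw f M N" and M: "submod M"
  shows "lin_map_on N (inv_into M f)"
proof -
  let ?g = "inv_into M f"
  have g: "?g w \<in> M" "f (?g w) = w" if "w \<in> N" for w
    using f(2) that by (metis bij_betw_imp_surj_on f_inv_into_f inv_into_into)+
  have inj: "v = v'" if "f v = f v'" "v \<in> M" "v' \<in> M" for v v'
    using that f(2) by (meson bij_betw_imp_inj_on inj_onD)
  have N: "submod N" using submod_mod_iso[OF _ M] f unfolding mod_iso_def by blast
  show ?thesis
    unfolding lin_map_on_def
  proof (intro conjI ballI allI)
    fix v w assume vw: "v \<in> N" "w \<in> N"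
    have "f (?g (vadd v w)) = f (vadd (?g v) (?g w))"
      using vw by (simp add: g submod_add[OF N] lin_map_on_add[OF f(1)])
    then show "?g (vadd v w) = vadd (?g v) (?g w)"
      by (rule inj) (use vw in \<open>auto intro: g(1) submod_add[OF N] submod_add[OF M]\<close>)
  next
    fix r w assume w: "w \<in> N"
    have "f (?g (vscale r w)) = f (vscale r (?g w))"
      using w by (simp add: g submod_scale[OF N] lin_map_on_scale[OF f(1)])
    then show "?g (vscale r w) = vscale r (?g w)"
      by (rule inj) (use w in \<open>auto intro: g(1) submod_scale[OF N] submod_scale[OF M]\<close>)
  qed
qed

lemma mod_iso_sym: "mod_iso M N \<Longrightarrow> submod M \<Longrightarrow> mod_iso N M"
  using lin_map_on_inv_into bij_betw_inv_into unfolding mod_iso_def by blast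

lemma mod_iso_trans:
  assumes "mod_iso M N" "mod_iso N L"
  shows "mod_iso M L"
proof -
  obtain f g where f: "lin_map_on M f" "bij_betw f M N" and g: "lin_map_on N g" "bij_betw g N L"
    using assms unfolding mod_iso_def by blast
  have fN: "f v \<in> N" if "v \<in> M" for v using f(2) that by (rule bij_betwE[THEN bspec])
  have "lin_map_on M (g \<circ> f)"
    unfolding lin_map_on_def
    by (simp add: fN lin_map_on_add[OF f(1)] lin_map_on_scale[OF f(1)] lin_map_on_add[OF g(1)] lin_map_on_scale[OF g(1)])
  then show ?thesis using bij_betw_trans[OF f(2) g(2)] unfolding mod_iso_def by blast
qed

text \<open>This is the splitting condition of \<open>fg_proj\<close> with an arbitrary module in
  place of the free one; sums of many modules are treated by splitting off the last summand
  repeatedly.\<close>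

definition internal_sum :: "(nat \<Rightarrow> 'a::comm_ring_1) set \<Rightarrow> (nat \<Rightarrow> 'a) set \<Rightarrow> (nat \<Rightarrow> 'a) set \<Rightarrow> bool" where
  "internal_sum X A B \<longleftrightarrow> submod A \<and> submod B \<and> A \<inter> B = {\<lambda>_. 0} \<and>
     {vadd v w | v w. v \<in> A \<and> w \<in> B} = X"

lemma internal_sum_submods: "internal_sum X A B \<Longrightarrow> submod A" "internal_sum X A B \<Longrightarrow> submod B"
  by (auto simp: internal_sum_def)

lemma internal_sum_memI: "internal_sum X A B \<Longrightarrow> a \<in> A \<Longrightarrow> b \<in> B \<Longrightarrow> vadd a b \<in> X"
  by (auto simp: internal_sum_def)

lemma internal_sum_memE:
  assumes "internal_sum X A B" "x \<in> X"
  obtains a b where "a \<in> A" "b \<in> B" "x = vadd a b"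
  using assms by (auto simp: internal_sum_def)

lemma internal_sum_unique:
  assumes X: "internal_sum X A B" and a: "a \<in> A" "a' \<in> A" and b: "b \<in> B" "b' \<in> B"
    and eq: "vadd a b = vadd a' b'"
  shows "a = a'" "b = b'"
proof -
  have e: "a i - a' i = b' i - b i" for i
    using fun_cong[OF eq, of i] by (simp add: vadd_def algebra_simps)
  have "(\<lambda>i. a i - a' i) \<in> A" using internal_sum_submods(1)[OF X] a by (rule submod_diff)
  moreover have "(\<lambda>i. a i - a' i) \<in> B"
    unfolding e using internal_sum_submods(2)[OF X] b(2,1) by (rule submod_diff)
  ultimately have "(\<lambda>i. a i - a' i) = (\<lambda>_. 0)" using X by (auto simp: internal_sum_def)
  then have z: "a i - a' i = 0" for i by (rule fun_cong)
  show "a = a'" using z by auto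
  show "b = b'" using z e by (metis ext eq_iff_diff_eq_0)
qed

lemma internal_sum_subset:
  assumes "internal_sum X A B"
  shows "A \<subseteq> X" "B \<subseteq> X"
proof -
  have "vadd a (\<lambda>_. 0) = a" "vadd (\<lambda>_. 0) a = a" for a :: "nat \<Rightarrow> 'a" by (simp_all add: vadd_def)
  then show "A \<subseteq> X" "B \<subseteq> X"
    using internal_sum_memI[OF assms] internal_sum_submods[OF assms, THEN submod_zero] by (metis subsetI)+
qed

lemma vadd_swap: "vadd (vadd a b) (vadd c d) = vadd (vadd a c) (vadd b d)"
  and vscale_vadd: "vscale r (vadd a b) = vadd (vscale r a) (vscale r b)"
  by (auto simp: vadd_def vscale_def algebra_simps)

lemma internal_sum_image:
  assumes X: "internal_sum X A B" and f: "lin_map_on X f" "inj_on f X"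
  shows "internal_sum (f ` X) (f ` A) (f ` B)"
proof -
  note AB = internal_sum_submods[OF X] and sub = internal_sum_subset[OF X]
  have lin: "lin_map_on A f" "lin_map_on B f" using f(1) sub by (auto intro: lin_map_on_subset)
  have "f ` A \<inter> f ` B = f ` (A \<inter> B)" using inj_on_image_Int[OF f(2) sub] by simp
  also have "\<dots> = {\<lambda>_. 0}"
    using X lin_map_on_zero[OF lin(1) AB(1)] by (simp add: internal_sum_def)
  finally have "f ` A \<inter> f ` B = {\<lambda>_. 0}" .
  moreover have "{vadd v w |v w. v \<in> f ` A \<and> w \<in> f ` B} = f ` X"
  proof (intro equalityI subsetI)
    fix y assume "y \<in> {vadd v w |v w. v \<in> f ` A \<and> w \<in> f ` B}"
    then obtain a b where "a \<in> A" "b \<in> B" "y = vadd (f a) (f b)" by blast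
    then have "y = f (vadd a b)" "vadd a b \<in> X"
      using sub f(1) internal_sum_memI[OF X] by (auto simp: lin_map_on_add subset_iff)
    then show "y \<in> f ` X" by blast
  next
    fix y assume "y \<in> f ` X"
    then obtain x where x: "x \<in> X" "y = f x" by blast
    obtain a b where "a \<in> A" "b \<in> B" "x = vadd a b" using X x(1) by (rule internal_sum_memE)
    then have "y = vadd (f a) (f b)" "a \<in> A" "b \<in> B"
      using sub f(1) x(2) by (auto simp: lin_map_on_add subset_iff)
    then show "y \<in> {vadd v w |v w. v \<in> f ` A \<and> w \<in> f ` B}" by blast
  qed
  ultimately show ?thesis
    unfolding internal_sum_def using submod_image[OF lin(1) AB(1)] submod_image[OF lin(2) AB(2)] by blast
qed

lemma mod_iso_internal_sum:
  assumes X: "internal_sum X A B" and Y: "internal_sum Y C D"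
    and iso: "mod_iso A C" "mod_iso B D"
  shows "mod_iso X Y"
proof -
  note AB = internal_sum_submods[OF X]
  obtain f g where f: "lin_map_on A f" "bij_betw f A C" and g: "lin_map_on B g" "bij_betw g B D"
    using iso unfolding mod_iso_def by blast
  have "\<forall>x\<in>X. \<exists>a b. a \<in> A \<and> b \<in> B \<and> x = vadd a b" by (metis internal_sum_memE[OF X])
  then obtain p q where pq: "\<And>x. x \<in> X \<Longrightarrow> p x \<in> A \<and> q x \<in> B \<and> x = vadd (p x) (q x)" by metis
  have pq_vadd: "p (vadd a b) = a" "q (vadd a b) = b" if "a \<in> A" "b \<in> B" for a b
    using internal_sum_unique[OF X] pq internal_sum_memI[OF X] that by metis+
  define h where "h x = vadd (f (p x)) (g (q x))" for x
  have h: "h (vadd a b) = vadd (f a) (g b)" if "a \<in> A" "b \<in> B" for a b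
    using that by (simp add: h_def pq_vadd)
  have fC: "f a \<in> C" if "a \<in> A" for a using bij_betwE[OF f(2)] that by blast
  have gD: "g b \<in> D" if "b \<in> B" for b using bij_betwE[OF g(2)] that by blast
  have "lin_map_on X h"
    unfolding lin_map_on_def
  proof (intro conjI ballI allI)
    fix x assume "x \<in> X"
    then obtain a b where x: "a \<in> A" "b \<in> B" "x = vadd a b" by (rule internal_sum_memE[OF X])
    show "h (vscale r x) = vscale r (h x)" for r
      using x by (simp add: vscale_vadd h submod_scale[OF AB(1)] submod_scale[OF AB(2)]
          lin_map_on_scale[OF f(1)] lin_map_on_scale[OF g(1)])
    fix y assume "y \<in> X"
    then obtain c d where y: "c \<in> A" "d \<in> B" "y = vadd c d" by (rule internal_sum_memE[OF X])
    have "vadd x y = vadd (vadd a c) (vadd b d)" unfolding x(3) y(3) by (rule vadd_swap)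
    then have "h (vadd x y) = vadd (vadd (f a) (f c)) (vadd (g b) (g d))"
      using x y by (simp add: h submod_add[OF AB(1)] submod_add[OF AB(2)]
          lin_map_on_add[OF f(1)] lin_map_on_add[OF g(1)])
    also have "\<dots> = vadd (h x) (h y)"
      unfolding x(3) y(3) h[OF x(1,2)] h[OF y(1,2)] by (rule vadd_swap)
    finally show "h (vadd x y) = vadd (h x) (h y)" .
  qed
  moreover have "inj_on h X"
  proof (rule inj_onI)
    fix x y assume xy: "x \<in> X" "y \<in> X" "h x = h y"
    note px = pq[OF xy(1)] and py = pq[OF xy(2)]
    have "f (p x) = f (p y)" "g (q x) = g (q y)"
      using internal_sum_unique[OF Y, of "f (p x)" "f (p y)" "g (q x)" "g (q y)"] xy(3) px py fC gD
      unfolding h_def by auto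
    then have "p x = p y" "q x = q y"
      using inj_on_eq_iff[OF bij_betw_imp_inj_on[OF f(2)], of "p x" "p y"]
        inj_on_eq_iff[OF bij_betw_imp_inj_on[OF g(2)], of "q x" "q y"] px py by simp_all
    then show "x = y" using px py by metis
  qed
  moreover have "h ` X = Y"
  proof (intro equalityI subsetI)
    fix y assume "y \<in> h ` X"
    then obtain x where "x \<in> X" "y = h x" by blast
    then show "y \<in> Y" using pq fC gD internal_sum_memI[OF Y] unfolding h_def by blast
  next
    fix y assume "y \<in> Y"
    then obtain c d where y: "c \<in> C" "d \<in> D" "y = vadd c d" by (rule internal_sum_memE[OF Y])
    obtain a b where "a \<in> A" "c = f a" "b \<in> B" "d = g b"
      using y f(2) g(2) by (metis bij_betw_imp_surj_on imageE)
    then have "y = h (vadd a b)" "vadd a b \<in> X" using y h internal_sum_memI[OF X] by auto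
    then show "y \<in> h ` X" by blast
  qed
  ultimately show ?thesis unfolding mod_iso_def bij_betw_def by blast
qed

subsection \<open>Direct sums of ideals\<close>

text \<open>The standard model of a projective module: the length of the list is the rank, and the
  product of the list represents the Steinitz class. The empty list gives the zero module.\<close>

definition ideal_dsum :: "'a::idom nzideal list \<Rightarrow> (nat \<Rightarrow> 'a) set" where
  "ideal_dsum Is = {v. (\<forall>i<length Is. v i \<in> iset (Is ! i)) \<and> (\<forall>i\<ge>length Is. v i = 0)}"

lemma submod_ideal_dsum: "submod (ideal_dsum Is)"
  by (auto simp: submod_def ideal_dsum_def vadd_def vscale_def intro: r_ideal_add r_ideal_mult)

lemma ideal_dsum_subset_free: "ideal_dsum Is \<subseteq> free_mod (length Is)"
  by (auto simp: ideal_dsum_def free_mod_def)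

lemma ideal_dsum_replicate_1: "ideal_dsum (replicate n 1) = free_mod n"
  by (auto simp: ideal_dsum_def free_mod_def iset_one)

text \<open>Two models both start at coordinate 0; shifting one of them past the other turns their
  external sum into an internal one.\<close>

definition shift_vec :: "nat \<Rightarrow> (nat \<Rightarrow> 'a::comm_ring_1) \<Rightarrow> nat \<Rightarrow> 'a" where
  "shift_vec k v = (\<lambda>i. if i < k then 0 else v (i - k))"

lemma lin_map_on_shift_vec: "lin_map_on M (shift_vec k)"
  by (auto simp: lin_map_on_def shift_vec_def vadd_def vscale_def)

lemma inj_shift_vec: "inj_on (shift_vec k) M"
proof (rule inj_onI)
  fix v w :: "nat \<Rightarrow> 'a" assume eq: "shift_vec k v = shift_vec k w"
  show "v = w"
  proof
    fix i show "v i = w i" using fun_cong[OF eq, of "i + k"] by (simp add: shift_vec_def)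
  qed
qed

lemma internal_sum_append:
  "internal_sum (ideal_dsum (L @ L')) (ideal_dsum L) (shift_vec (length L) ` ideal_dsum L')"
proof -
  let ?k = "length L"
  have "ideal_dsum L \<inter> shift_vec ?k ` ideal_dsum L' = {\<lambda>_. 0}"
  proof (intro equalityI subsetI)
    fix x assume "x \<in> ideal_dsum L \<inter> shift_vec ?k ` ideal_dsum L'"
    then have "x i = 0" for i by (cases "i < ?k") (auto simp: shift_vec_def ideal_dsum_def)
    then show "x \<in> {\<lambda>_. 0}" by auto
  qed (auto intro: submod_zero submod_image submod_ideal_dsum lin_map_on_shift_vec)
  moreover have "{vadd v w |v w. v \<in> ideal_dsum L \<and> w \<in> shift_vec ?k ` ideal_dsum L'} = ideal_dsum (L @ L')"
  proof (intro equalityI subsetI)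
    fix x assume "x \<in> {vadd v w |v w. v \<in> ideal_dsum L \<and> w \<in> shift_vec ?k ` ideal_dsum L'}"
    then obtain v w where "v \<in> ideal_dsum L" "w \<in> ideal_dsum L'" "x = vadd v (shift_vec ?k w)" by blast
    then show "x \<in> ideal_dsum (L @ L')"
      by (auto simp: ideal_dsum_def vadd_def shift_vec_def nth_append)
  next
    fix x assume x: "x \<in> ideal_dsum (L @ L')"
    define v w where "v = (\<lambda>i. if i < ?k then x i else 0)" and "w = (\<lambda>i. x (i + ?k))"
    have "x (i + ?k) \<in> iset (L' ! i)" if "i < length L'" for i
      using x that unfolding ideal_dsum_def
      by (auto dest!: spec[of _ "i + ?k"] simp: nth_append)
    then have "w \<in> ideal_dsum L'" using x by (auto simp: ideal_dsum_def w_def)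
    moreover have "x i \<in> iset (L ! i)" if "i < ?k" for i
      using x that unfolding ideal_dsum_def by (auto dest!: spec[of _ i] simp: nth_append)
    then have "v \<in> ideal_dsum L" by (auto simp: ideal_dsum_def v_def)
    moreover have "x = vadd v (shift_vec ?k w)" by (auto simp: vadd_def shift_vec_def v_def w_def)
    ultimately show "x \<in> {vadd v w |v w. v \<in> ideal_dsum L \<and> w \<in> shift_vec ?k ` ideal_dsum L'}" by blast
  qed
  ultimately show ?thesis
    unfolding internal_sum_def
    by (auto intro: submod_ideal_dsum submod_image lin_map_on_shift_vec)
qed

lemma mod_iso_shift_vec: "mod_iso (ideal_dsum L) (shift_vec k ` ideal_dsum L)"
  by (intro mod_iso_image lin_map_on_shift_vec inj_shift_vec)

text \<open>From left to right, the two coordinate blocks are transported along the isomorphism;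
  from right to left, the isomorphisms of the summands are glued. Concatenation of lists thus
  expresses direct sums up to isomorphism.\<close>

lemma mod_iso_ideal_dsum_append_iff:
  assumes "submod X"
  shows "mod_iso X (ideal_dsum (L @ L')) \<longleftrightarrow>
    (\<exists>A B. internal_sum X A B \<and> mod_iso A (ideal_dsum L) \<and> mod_iso B (ideal_dsum L'))"
proof
  assume "mod_iso X (ideal_dsum (L @ L'))"
  then have "mod_iso (ideal_dsum (L @ L')) X" using mod_iso_sym assms by blast
  then obtain f where f: "lin_map_on (ideal_dsum (L @ L')) f" "inj_on f (ideal_dsum (L @ L'))"
    "f ` ideal_dsum (L @ L') = X" unfolding mod_iso_def bij_betw_def by blast
  let ?A = "ideal_dsum L" and ?B = "shift_vec (length L) ` ideal_dsum L'"
  have "internal_sum X (f ` ?A) (f ` ?B)"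
    using internal_sum_image[OF internal_sum_append f(1,2)] f(3) by simp
  moreover have iso: "mod_iso (f ` S) S" if "S \<subseteq> ideal_dsum (L @ L')" "submod S" for S
  proof (rule mod_iso_sym[OF mod_iso_image that(2)])
    show "lin_map_on S f" using f(1) that(1) by (rule lin_map_on_subset)
    show "inj_on f S" using f(2) that(1) by (rule inj_on_subset)
  qed
  have "mod_iso (f ` ?A) ?A" "mod_iso (f ` ?B) ?B"
    using internal_sum_subset[OF internal_sum_append] internal_sum_submods[OF internal_sum_append]
    by (blast intro: iso)+
  moreover have "mod_iso ?B (ideal_dsum L')"
    by (rule mod_iso_sym[OF mod_iso_shift_vec submod_ideal_dsum])
  ultimately show "\<exists>A B. internal_sum X A B \<and> mod_iso A (ideal_dsum L) \<and> mod_iso B (ideal_dsum L')"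
    using mod_iso_trans by blast
next
  assume "\<exists>A B. internal_sum X A B \<and> mod_iso A (ideal_dsum L) \<and> mod_iso B (ideal_dsum L')"
  then show "mod_iso X (ideal_dsum (L @ L'))"
    using mod_iso_internal_sum[OF _ internal_sum_append] mod_iso_trans[OF _ mod_iso_shift_vec] by blast
qed

lemma mod_iso_ideal_dsum_append:
  assumes "mod_iso (ideal_dsum L) (ideal_dsum M)" "mod_iso (ideal_dsum L') (ideal_dsum M')"
  shows "mod_iso (ideal_dsum (L @ L')) (ideal_dsum (M @ M'))"
proof -
  have "mod_iso (shift_vec (length L) ` ideal_dsum L') (ideal_dsum M')"
    using mod_iso_sym[OF mod_iso_shift_vec submod_ideal_dsum] assms(2) mod_iso_trans by blast
  then show ?thesis
    using mod_iso_ideal_dsum_append_iff[OF submod_ideal_dsum] internal_sum_append assms(1) by blast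
qed

lemma mod_iso_ideal_dsum_principal:
  assumes "a \<noteq> 0"
  shows "mod_iso (ideal_dsum [I]) (ideal_dsum [principal_nzideal a * I])"
proof -
  have "vscale a ` ideal_dsum [I] = ideal_dsum [principal_nzideal a * I]"
  proof (intro equalityI subsetI)
    fix v assume "v \<in> ideal_dsum [principal_nzideal a * I]"
    then obtain t where t: "t \<in> iset I" "v 0 = a * t" "\<forall>i\<ge>1. v i = 0"
      using assms by (auto simp: ideal_dsum_def iset_principal_times)
    then have "v = vscale a (\<lambda>i. if i = 0 then t else 0)" by (auto simp: vscale_def fun_eq_iff)
    moreover have "(\<lambda>i. if i = 0 then t else 0) \<in> ideal_dsum [I]" using t(1) by (simp add: ideal_dsum_def)
    ultimately show "v \<in> vscale a ` ideal_dsum [I]" by blast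
  qed (use assms in \<open>auto simp: ideal_dsum_def iset_principal_times vscale_def\<close>)
  moreover have "mod_iso (ideal_dsum [I]) (vscale a ` ideal_dsum [I])"
    by (rule mod_iso_image)
      (use assms in \<open>auto simp: lin_map_on_def inj_on_def vscale_def vadd_def algebra_simps fun_eq_iff\<close>)
  ultimately show ?thesis by simp
qed

lemma mod_iso_ideal_dsum_equiv:
  assumes "ideal_equiv I J"
  shows "mod_iso (ideal_dsum [I]) (ideal_dsum [J])"
proof -
  obtain a b where ab: "a \<noteq> 0" "b \<noteq> 0" "principal_nzideal a * I = principal_nzideal b * J"
    using assms unfolding ideal_equiv_def by blast
  have "mod_iso (ideal_dsum [principal_nzideal b * J]) (ideal_dsum [J])"
    by (rule mod_iso_sym[OF mod_iso_ideal_dsum_principal[OF ab(2)] submod_ideal_dsum])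
  then show ?thesis
    using mod_iso_trans[OF mod_iso_ideal_dsum_principal[OF ab(1), of I]] ab(3) by simp
qed

text \<open>The addition map from the sum of \<open>I\<close> and \<open>J\<close> to the ring is
  onto because u + v = 1, and its kernel is the intersection of \<open>I\<close> and
  \<open>J\<close>, which equals \<open>I * J\<close>. The map \<open>?f\<close> pairs it with the
  retraction v x_0 - u x_1 onto this kernel, and \<open>?g\<close> is the explicit inverse.\<close>

lemma mod_iso_ideal_dsum_coprime:
  assumes uv: "u \<in> iset I" "v \<in> iset J" "u + v = 1"
  shows "mod_iso (ideal_dsum [I, J]) (ideal_dsum [I * J, 1])"
proof (rule mod_isoI)
  let ?f = "\<lambda>x (i::nat). if i = 0 then v * x 0 - u * x 1 else if i = 1 then x 0 + x 1 else 0"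
  let ?g = "\<lambda>y (i::nat). if i = 0 then y 1 * u + y 0 else if i = 1 then y 1 * v - y 0 else (0::'a)"
  have v: "v = 1 - u" using uv(3) by (simp add: algebra_simps)
  have prodI: "a * b \<in> iset (I * J)" "b * a \<in> iset (I * J)" if "a \<in> iset I" "b \<in> iset J" for a b
    using ideal_prod_memI[OF that] by (simp_all add: iset_times mult.commute)
  show "lin_map_on (ideal_dsum [I, J]) ?f"
    by (auto simp: lin_map_on_def vadd_def vscale_def fun_eq_iff algebra_simps)
  fix x assume x: "x \<in> ideal_dsum [I, J]"
  then have x': "x 0 \<in> iset I" "x 1 \<in> iset J" "\<And>i. i \<ge> 2 \<Longrightarrow> x i = 0"
    by (auto simp: ideal_dsum_def less_Suc_eq)
  have "v * x 0 - u * x 1 \<in> iset (I * J)"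
    using x' uv by (intro r_ideal_diff prodI(1)[of u "x 1"] prodI(2)[of "x 0" v]) simp_all
  then show "?f x \<in> ideal_dsum [I * J, 1]"
    by (auto simp: ideal_dsum_def less_Suc_eq iset_one)
  have "x i = 0" if "i \<noteq> 0" "i \<noteq> Suc 0" for i using x'(3)[of i] that by simp
  then show "?g (?f x) = x"
    by (auto simp: fun_eq_iff v algebra_simps)
next
  let ?f = "\<lambda>x (i::nat). if i = 0 then v * x 0 - u * x 1 else if i = 1 then x 0 + x 1 else 0"
  let ?g = "\<lambda>y (i::nat). if i = 0 then y 1 * u + y 0 else if i = 1 then y 1 * v - y 0 else (0::'a)"
  have v: "v = 1 - u" using uv(3) by (simp add: algebra_simps)
  have prod_sub: "iset (I * J) \<subseteq> iset I" "iset (I * J) \<subseteq> iset J"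
    using ideal_prod_subset[of "iset I" "iset J"] ideal_prod_subset[of "iset J" "iset I"]
    by (simp_all add: iset_times ideal_prod_commute)
  fix y assume y: "y \<in> ideal_dsum [I * J, 1]"
  then have y': "y 0 \<in> iset I" "y 0 \<in> iset J" "\<And>i. i \<ge> 2 \<Longrightarrow> y i = 0"
    using prod_sub by (auto simp: ideal_dsum_def less_Suc_eq)
  show "?g y \<in> ideal_dsum [I, J]"
    using y' uv by (auto simp: ideal_dsum_def less_Suc_eq intro!: r_ideal_add r_ideal_diff r_ideal_mult)
  have "y i = 0" if "i \<noteq> 0" "i \<noteq> Suc 0" for i using y'(3)[of i] that by simp
  then show "?f (?g y) = y"
    by (auto simp: fun_eq_iff v algebra_simps)
qed

subsection \<open>Rank\<close>

text \<open>Written as columns of an \<open>r\<close> by \<open>r\<close> matrix, the vectors leave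
  row \<open>m\<close> zero. Every term of the determinant expansion therefore vanishes, and a
  singular matrix over a domain has a nonzero kernel vector.\<close>

lemma linear_dependence:
  fixes w :: "nat \<Rightarrow> nat \<Rightarrow> 'a::idom"
  assumes w: "\<And>j. j < r \<Longrightarrow> w j \<in> free_mod m" and "m < r"
  shows "\<exists>c. (\<exists>j<r. c j \<noteq> 0) \<and> (\<lambda>i. \<Sum>j<r. c j * w j i) = (\<lambda>_. 0)"
proof -
  define A where "A = mat r r (\<lambda>(i, j). w j i)"
  have A: "A \<in> carrier_mat r r" by (simp add: A_def)
  have "(\<Prod>i = 0..<r. A $$ (i, p i)) = 0" if "p permutes {0..<r}" for p
  proof (rule prod_zero)
    have "p m < r" using that \<open>m < r\<close> permutes_in_image by fastforce
    then have "A $$ (m, p m) = 0" using \<open>m < r\<close> w[of "p m"] by (simp add: A_def free_mod_def)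
    then show "\<exists>i\<in>{0..<r}. A $$ (i, p i) = 0" using \<open>m < r\<close> by force
  qed simp
  then have "det A = 0" unfolding det_def'[OF A] by (intro sum.neutral ballI) (simp del: prod_zero_iff)
  then obtain v where v: "v \<in> carrier_vec r" "v \<noteq> 0\<^sub>v r" "A *\<^sub>v v = 0\<^sub>v r"
    using det_0_iff_vec_prod_zero[OF A] by blast
  have "\<exists>j<r. v $ j \<noteq> 0"
  proof (rule ccontr)
    assume "\<not> (\<exists>j<r. v $ j \<noteq> 0)"
    then have "v = 0\<^sub>v r" using v(1) by (intro eq_vecI) auto
    then show False using v(2) by blast
  qed
  moreover have "(\<Sum>j<r. v $ j * w j i) = 0" for i
  proof (cases "i < r")
    case True
    have "0 = (A *\<^sub>v v) $ i" using v(3) True by simp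
    also have "\<dots> = (\<Sum>j<r. v $ j * w j i)"
      using True v(1) by (simp add: A_def scalar_prod_def atLeast0LessThan mult.commute)
    finally show ?thesis by simp
  next
    case False
    then show ?thesis using w \<open>m < r\<close> by (auto simp: free_mod_def)
  qed
  ultimately show ?thesis by (intro exI[of _ "\<lambda>j. v $ j"]) simp
qed

definition single_vec :: "nat \<Rightarrow> 'a::comm_ring_1 \<Rightarrow> nat \<Rightarrow> 'a" where
  "single_vec j a = (\<lambda>i. if i = j then a else 0)"

lemma sum_single_vec:
  "(\<Sum>j<r. c j * single_vec j (a j) i) = (if i < r then c i * a i else 0)"
  by (simp add: single_vec_def if_distrib[of "\<lambda>x. _ * x"] cong: if_cong)

lemma single_vec_in_ideal_dsum:
  "j < length L \<Longrightarrow> a \<in> iset (L ! j) \<Longrightarrow> single_vec j a \<in> ideal_dsum L"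
  by (auto simp: ideal_dsum_def single_vec_def)

text \<open>Transported to the model, an independent set lies in the free module of rank
  \<open>length L\<close> and cannot be larger than that. The bound is attained by nonzero multiples
  of the unit vectors, pulled back to \<open>X\<close>; it also gives the finiteness that
  \<open>Max\<close> requires.\<close>

lemma mod_rank_eq_length:
  fixes X :: "(nat \<Rightarrow> 'a::idom) set"
  assumes X: "submod X" and iso: "mod_iso X (ideal_dsum L)"
  shows "mod_rank X = length L"
proof -
  let ?r = "length L" and ?D = "ideal_dsum L"
  obtain f where f: "lin_map_on X f" "bij_betw f X ?D" using iso unfolding mod_iso_def by blast
  define g where "g = inv_into X f"
  have g: "lin_map_on ?D g" unfolding g_def by (rule lin_map_on_inv_into[OF f X])
  have gX: "g w \<in> X" and fg: "f (g w) = w" if "w \<in> ?D" for w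
    using f(2) that unfolding g_def
    by (simp_all add: bij_betw_def f_inv_into_f inv_into_into)
  have f0: "f v = (\<lambda>_. 0) \<longleftrightarrow> v = (\<lambda>_. 0)" if "v \<in> X" for v
    using inj_on_eq_iff[OF bij_betw_imp_inj_on[OF f(2)] that submod_zero[OF X]]
      lin_map_on_zero[OF f(1) X] by simp
  have le: "card S \<le> ?r" if S: "finite S" "S \<subseteq> X" "lin_indep S" for S
  proof (rule ccontr)
    assume "\<not> card S \<le> ?r"
    obtain w where w: "bij_betw w {..<card S} S"
      using ex_bij_betw_nat_finite[OF S(1)] by (auto simp: atLeast0LessThan)
    have wX: "w j \<in> X" if "j < card S" for j using bij_betwE[OF w] that S(2) by blast
    have "f (w j) \<in> free_mod ?r" if "j < card S" for j
      using bij_betwE[OF f(2)] wX[OF that] ideal_dsum_subset_free by blast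
    then obtain c where c: "\<exists>j<card S. c j \<noteq> 0" "(\<lambda>i. \<Sum>j<card S. c j * f (w j) i) = (\<lambda>_. 0)"
      using linear_dependence[of "card S" "\<lambda>j. f (w j)" ?r] \<open>\<not> card S \<le> ?r\<close> by auto
    have mem: "(\<lambda>i. \<Sum>j<card S. c j * w j i) \<in> X"
      using submod_sum[OF X, of "{..<card S}" "\<lambda>j. vscale (c j) (w j)"] submod_scale[OF X] wX
      by (simp add: vscale_def)
    have "f (\<lambda>i. \<Sum>j<card S. c j * w j i) = (\<lambda>_. 0)"
      using lin_map_on_sum[OF f(1) X, of "{..<card S}" w c] wX c(2) by simp
    then have "(\<lambda>i. \<Sum>j<card S. c j * w j i) = (\<lambda>_. 0)" using f0[OF mem] by simp
    \<comment> \<open>In \<open>lin_indep\<close> the coefficients are indexed by the vectors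
      themselves, so the relation over \<open>{..<card S}\<close> is carried over along the
      enumeration \<open>w\<close>.\<close>
    moreover define c' where "c' s = c (inv_into {..<card S} w s)" for s
    have c': "c' (w j) = c j" if "j < card S" for j
      using that w by (simp add: c'_def bij_betw_def)
    have "(\<Sum>s\<in>S. c' s * s i) = (\<Sum>j<card S. c j * w j i)" for i
      using sum.reindex_bij_betw[OF w, of "\<lambda>s. c' s * s i"] by (simp add: c')
    ultimately have "(\<lambda>i. \<Sum>s\<in>S. c' s * s i) = (\<lambda>_. 0)" by simp
    then have "\<forall>s\<in>S. c' s = 0" using S(3) unfolding lin_indep_def by blast
    then show False using c(1) c' bij_betwE[OF w] by (metis lessThan_iff)
  qed
  \<comment> \<open>The unit vectors need not lie in the model, as 1 need not lie in the ideals; any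
    nonzero entries serve equally well for independence.\<close>
  have "\<exists>x. x \<in> iset (L ! j) \<and> x \<noteq> 0" for j using iset_nonzeroE[of "L ! j"] by blast
  then obtain a where a: "\<And>j. a j \<in> iset (L ! j)" "\<And>j. a j \<noteq> 0" by metis
  define e where "e j = single_vec j (a j)" for j
  have eD: "e j \<in> ?D" if "j < ?r" for j
    unfolding e_def using that a(1) by (rule single_vec_in_ideal_dsum)
  define S where "S = (\<lambda>j. g (e j)) ` {..<?r}"
  have e_inj: "j = k" if "e j = e k" for j k
    using fun_cong[OF that, of j] a(2)[of j] by (auto simp: e_def single_vec_def split: if_splits)
  have inj: "inj_on (\<lambda>j. g (e j)) {..<?r}"
    using fg eD e_inj by (intro inj_onI) (metis lessThan_iff)
  have "lin_indep S"
    unfolding lin_indep_def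
  proof (intro allI impI ballI)
    fix c s assume c: "(\<lambda>i. \<Sum>s\<in>S. c s * s i) = (\<lambda>_. 0)" and "s \<in> S"
    then obtain k where k: "k < ?r" "s = g (e k)" by (auto simp: S_def)
    have "(\<lambda>i. \<Sum>s\<in>S. c s * s i) = (\<lambda>i. \<Sum>j<?r. c (g (e j)) * g (e j) i)"
      unfolding S_def by (simp add: sum.reindex[OF inj])
    then have "f (\<lambda>i. \<Sum>j<?r. c (g (e j)) * g (e j) i) = (\<lambda>_. 0)"
      using c lin_map_on_zero[OF f(1) X] by simp
    then have "(\<lambda>i. \<Sum>j<?r. c (g (e j)) * f (g (e j)) i) = (\<lambda>_. 0)"
      using lin_map_on_sum[OF f(1) X, of "{..<?r}" "\<lambda>j. g (e j)"] gX eD by simp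
    then have "(\<Sum>j<?r. c (g (e j)) * e j k) = 0"
      using fg eD by (auto dest: fun_cong[of _ _ k])
    then show "c s = 0" using k a(2)[of k] by (simp add: e_def sum_single_vec)
  qed
  moreover have "S \<subseteq> X" "finite S" "card S = ?r"
    using gX eD card_image[OF inj] by (auto simp: S_def)
  ultimately have "?r \<in> {card S |S. finite S \<and> S \<subseteq> X \<and> lin_indep S}" by (intro CollectI exI[of _ S]) simp
  moreover have "finite {card S |S. finite S \<and> S \<subseteq> X \<and> lin_indep S}"
    by (rule finite_subset[of _ "{..?r}"]) (use le in auto)
  ultimately show ?thesis unfolding mod_rank_def by (intro Max_eqI) (use le in auto)
qed

lemma mod_rank_free_mod: "mod_rank (free_mod n :: (nat \<Rightarrow> 'a::idom) set) = n"
  using mod_rank_eq_length[OF submod_free_mod, of n "replicate n (1 :: 'a nzideal)"]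
  by (simp add: ideal_dsum_replicate_1 mod_iso_refl)

subsection \<open>Steinitz' theorem\<close>

lemma lin_map_on_free_mod:
  fixes v :: "nat \<Rightarrow> 'a::comm_ring_1"
  assumes "lin_map_on (free_mod n) f" "v \<in> free_mod n"
  shows "f v i = (\<Sum>j<n. v j * f (single_vec j 1) i)"
proof -
  have "(\<lambda>i. \<Sum>j<n. v j * single_vec j 1 i) = v"
    using assms(2) by (auto simp: sum_single_vec free_mod_def)
  moreover have "single_vec j (1::'a) \<in> free_mod n" if "j < n" for j
    using that by (auto simp: free_mod_def single_vec_def)
  ultimately have "f v = (\<lambda>i. \<Sum>j<n. v j * f (single_vec j 1) i)"
    using lin_map_on_sum[OF assms(1) submod_free_mod, of "{..<n}" "\<lambda>j. single_vec j 1" v]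
    by (simp only: lessThan_iff)
  then show ?thesis by (rule fun_cong)
qed

text \<open>The matrix of an isomorphism from the free module has determinant in \<open>P\<close>, because its first row
  does; and it divides each \<open>a \<in> P\<close>, because the diagonal matrix with entries \<open>a, 1, \<dots>, 1\<close> factors
  through it.\<close>

lemma free_mod_iso_imp_principal:
  fixes P :: "'a::idom nzideal"
  assumes iso: "mod_iso (free_mod (Suc k)) (ideal_dsum (P # replicate k 1))"
  shows "ideal_equiv P 1"
proof -
  let ?n = "Suc k" and ?D = "ideal_dsum (P # replicate k 1)"
  obtain f where f: "lin_map_on (free_mod ?n) f" "bij_betw f (free_mod ?n) ?D"
    using iso unfolding mod_iso_def by blast
  define A where "A = mat ?n ?n (\<lambda>(i, j). f (single_vec j 1) i)"
  have A: "A \<in> carrier_mat ?n ?n" by (simp add: A_def)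
  have fD: "f v \<in> ?D" if "v \<in> free_mod ?n" for v using bij_betwE[OF f(2)] that by blast
  have row: "A $$ (0, j) \<in> iset P" if "j < ?n" for j
  proof -
    have "single_vec j 1 \<in> free_mod ?n" using that by (auto simp: free_mod_def single_vec_def)
    then have "f (single_vec j 1) \<in> ?D" by (rule fD)
    then show ?thesis using that by (auto simp: ideal_dsum_def A_def)
  qed
  have "det A \<in> iset P"
    unfolding det_def'[OF A]
  proof (intro r_ideal_sum r_ideal_mult r_ideal_iset)
    fix p assume "p \<in> {p. p permutes {0..<?n}}"
    then have "p 0 < ?n" using permutes_in_image[of p "{0..<?n}" 0] by simp
    then have "A $$ (0, p 0) * (\<Prod>i = Suc 0..<?n. A $$ (i, p i)) \<in> iset P"
      using row by (intro r_ideal_mult_right) auto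
    then show "(\<Prod>i = 0..<?n. A $$ (i, p i)) \<in> iset P"
      by (simp only: prod.atLeast_Suc_lessThan[OF zero_less_Suc])
  qed
  moreover have dvd: "det A dvd a" if a: "a \<in> iset P" for a
  proof -
    define d where "d j = single_vec j (if j = 0 then a else 1)" for j
    have dD: "d j \<in> ?D" if "j < ?n" for j
      unfolding d_def using that a by (intro single_vec_in_ideal_dsum) (auto simp: iset_one nth_Cons split: nat.split)
    \<comment> \<open>The preimages under \<open>f\<close> of the columns of the diagonal matrix;
      they are the columns of the second factor \<open>B\<close>.\<close>
    define b where "b j = inv_into (free_mod ?n) f (d j)" for j
    have b: "b j \<in> free_mod ?n" "f (b j) = d j" if "j < ?n" for j
      using f(2) dD[OF that] unfolding b_def by (simp_all add: bij_betw_def f_inv_into_f inv_into_into)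
    define B where "B = mat ?n ?n (\<lambda>(i, j). b j i)"
    have B: "B \<in> carrier_mat ?n ?n" by (simp add: B_def)
    have "A * B = multrow_mat ?n 0 a"
    proof (rule eq_matI)
      fix i j assume "i < dim_row (multrow_mat ?n 0 a)" "j < dim_col (multrow_mat ?n 0 a)"
      then have ij: "i < ?n" "j < ?n" by auto
      have "(A * B) $$ (i, j) = (\<Sum>l<?n. b j l * f (single_vec l 1) i)"
        using ij by (simp add: A_def B_def scalar_prod_def atLeast0LessThan mult.commute del: sum.lessThan_Suc)
      also have "\<dots> = d j i" using lin_map_on_free_mod[OF f(1) b(1)[OF ij(2)]] b(2)[OF ij(2)] by metis
      also have "\<dots> = multrow_mat ?n 0 a $$ (i, j)"
        using ij by (auto simp: d_def single_vec_def)
      finally show "(A * B) $$ (i, j) = multrow_mat ?n 0 a $$ (i, j)" .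
    qed (simp_all add: A_def B_def)
    then have "a = det A * det B" using det_mult[OF A B] det_multrow_mat[of 0 ?n a] by simp
    then show ?thesis by simp
  qed
  moreover have nz: "det A \<noteq> 0"
    by (metis dvd iset_nonzeroE dvd_0_left)
  ultimately have "iset P = iset (principal_nzideal (det A))"
    using r_ideal_mult_right[OF r_ideal_iset, of "det A" P] by (auto simp: iset_principal dvd_def)
  then have "P = principal_nzideal (det A)" by (rule nzideal_eqI)
  then show ?thesis using ideal_equiv_principal[OF nz] by simp
qed

context dedekind
begin

text \<open>Replacing \<open>I\<close> by an equivalent ideal coprime to \<open>J\<close> changes
  neither side up to isomorphism and leads to the explicit coprime case.\<close>

lemma mod_iso_ideal_dsum_pair: "mod_iso (ideal_dsum [I, J]) (ideal_dsum [I * J, 1 :: 'a nzideal])"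
proof -
  obtain I' u v where I': "ideal_equiv I I'" "u \<in> iset I'" "v \<in> iset J" "u + v = 1"
    using coprime_representative by blast
  have "mod_iso (ideal_dsum ([I] @ [J])) (ideal_dsum ([I'] @ [J]))"
    using I'(1) by (intro mod_iso_ideal_dsum_append mod_iso_ideal_dsum_equiv) simp_all
  moreover have "mod_iso (ideal_dsum [I', J]) (ideal_dsum [I' * J, 1])"
    using I'(2-4) by (rule mod_iso_ideal_dsum_coprime)
  moreover have "mod_iso (ideal_dsum ([I' * J] @ [1])) (ideal_dsum ([I * J] @ [1]))"
    using I'(1) by (intro mod_iso_ideal_dsum_append mod_iso_ideal_dsum_equiv ideal_equiv_mult)
      (simp_all add: ideal_equiv_sym)
  ultimately show ?thesis using mod_iso_trans by simp blast
qed

lemma mod_iso_ideal_dsum_normal_form: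
  "L \<noteq> [] \<Longrightarrow> mod_iso (ideal_dsum L) (ideal_dsum (prod_list L # replicate (length L - 1) (1 :: 'a nzideal)))"
proof (induction L rule: list_nonempty_induct)
  case (single I)
  then show ?case by (simp add: mod_iso_refl)
next
  case (cons I L)
  let ?R = "replicate (length L - 1) (1 :: 'a nzideal)"
  have "mod_iso (ideal_dsum ([I] @ L)) (ideal_dsum ([I] @ prod_list L # ?R))"
    using cons by (intro mod_iso_ideal_dsum_append mod_iso_refl)
  moreover have "mod_iso (ideal_dsum ([I, prod_list L] @ ?R)) (ideal_dsum ([I * prod_list L, 1] @ ?R))"
    by (intro mod_iso_ideal_dsum_append mod_iso_refl mod_iso_ideal_dsum_pair)
  moreover have "1 # ?R = replicate (length L) 1"
    using cons.hyps by (metis Suc_diff_1 length_greater_0_conv replicate_Suc)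
  ultimately show ?case using mod_iso_trans by simp blast
qed

lemma mod_iso_ideal_dsumI:
  fixes L M :: "'a nzideal list"
  assumes "length L = length M" "ideal_equiv (prod_list L) (prod_list M)"
  shows "mod_iso (ideal_dsum L) (ideal_dsum M)"
proof (cases "L = []")
  case True
  then show ?thesis using assms by (simp add: mod_iso_refl)
next
  case False
  then have M: "M \<noteq> []" using assms by auto
  let ?R = "replicate (length M - 1) (1 :: 'a nzideal)"
  have "mod_iso (ideal_dsum ([prod_list L] @ ?R)) (ideal_dsum ([prod_list M] @ ?R))"
    using assms(2) by (intro mod_iso_ideal_dsum_append mod_iso_refl mod_iso_ideal_dsum_equiv)
  then have "mod_iso (ideal_dsum L) (ideal_dsum (prod_list M # ?R))"
    using mod_iso_trans[OF mod_iso_ideal_dsum_normal_form[OF False]] assms(1) by simp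
  then show ?thesis
    using mod_iso_trans mod_iso_sym[OF mod_iso_ideal_dsum_normal_form[OF M] submod_ideal_dsum] by blast
qed

lemma mod_iso_free_mod_iff:
  fixes L :: "'a nzideal list"
  shows "mod_iso (free_mod n) (ideal_dsum L) \<longleftrightarrow> length L = n \<and> ideal_equiv (prod_list L) 1"
proof
  assume iso: "mod_iso (free_mod n) (ideal_dsum L)"
  have len: "length L = n"
    using mod_rank_eq_length[OF submod_free_mod iso] by (simp add: mod_rank_free_mod)
  show "length L = n \<and> ideal_equiv (prod_list L) 1"
  proof (cases "L = []")
    case True
    then show ?thesis using len by simp
  next
    case False
    then have "mod_iso (free_mod n) (ideal_dsum (prod_list L # replicate (length L - 1) 1))"
      using mod_iso_trans[OF iso mod_iso_ideal_dsum_normal_form] by blast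
    moreover have "n = Suc (length L - 1)" using False len by (cases L) auto
    ultimately show ?thesis using free_mod_iso_imp_principal len by metis
  qed
next
  assume "length L = n \<and> ideal_equiv (prod_list L) 1"
  then have "mod_iso (ideal_dsum (replicate n 1)) (ideal_dsum L)"
    by (intro mod_iso_ideal_dsumI) (auto simp: prod_list_replicate ideal_equiv_sym)
  then show "mod_iso (free_mod n) (ideal_dsum L)" by (simp add: ideal_dsum_replicate_1)
qed

text \<open>The determinant argument compares with free modules only. An ideal \<open>J\<close>
  inverse to the product of \<open>L\<close> makes the sum over \<open>L @ [J]\<close> free, hence
  also the sum over \<open>M @ [J]\<close>; then both products are inverse to \<open>J\<close>, and
  \<open>J\<close> cancels.\<close>

lemma mod_iso_ideal_dsum_iff:
  fixes L M :: "'a nzideal list"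
  shows "mod_iso (ideal_dsum L) (ideal_dsum M) \<longleftrightarrow>
    length L = length M \<and> ideal_equiv (prod_list L) (prod_list M)"
proof
  assume iso: "mod_iso (ideal_dsum L) (ideal_dsum M)"
  have len: "length L = length M"
    using mod_rank_eq_length[OF submod_ideal_dsum iso]
      mod_rank_eq_length[OF submod_ideal_dsum mod_iso_refl[of "ideal_dsum L"]] by simp
  obtain J where J: "ideal_equiv (prod_list L * J) 1" using ideal_equiv_inverse by blast
  have "mod_iso (free_mod (Suc (length L))) (ideal_dsum (L @ [J]))"
    using J by (simp add: mod_iso_free_mod_iff)
  moreover have "mod_iso (ideal_dsum (L @ [J])) (ideal_dsum (M @ [J]))"
    using iso by (intro mod_iso_ideal_dsum_append mod_iso_refl)
  ultimately have "mod_iso (free_mod (Suc (length L))) (ideal_dsum (M @ [J]))" by (rule mod_iso_trans)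
  then have "ideal_equiv (prod_list M * J) 1" by (simp add: mod_iso_free_mod_iff)
  then have "ideal_equiv (prod_list L * J) (prod_list M * J)"
    using J ideal_equiv_sym ideal_equiv_trans by blast
  then show "length L = length M \<and> ideal_equiv (prod_list L) (prod_list M)"
    using len ideal_equiv_cancel by blast
qed (simp add: mod_iso_ideal_dsumI)

text \<open>The multiples of the identity of \<open>I\<close> that lift to \<open>M\<close> form an ideal; invertibility of \<open>I\<close> shows
  that it contains \<open>1\<close>.\<close>

lemma exists_section:
  fixes M :: "(nat \<Rightarrow> 'a) set"
  assumes M: "submod M" and I: "iset I = (\<lambda>v. v m) ` M"
  shows "\<exists>s. (\<forall>t\<in>iset I. s t \<in> M \<and> s t m = t) \<and>
    (\<forall>t\<in>iset I. \<forall>t'\<in>iset I. s (t + t') = vadd (s t) (s t')) \<and>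
    (\<forall>r. \<forall>t\<in>iset I. s (r * t) = vscale r (s t))"
proof -
  define lin where "lin s \<longleftrightarrow> (\<forall>t\<in>iset I. s t \<in> M) \<and>
    (\<forall>t\<in>iset I. \<forall>t'\<in>iset I. s (t + t') = vadd (s t) (s t')) \<and>
    (\<forall>r. \<forall>t\<in>iset I. s (r * t) = vscale r (s t))" for s
  obtain c where c: "c \<in> iset I" "c \<noteq> 0" by (rule iset_nonzeroE)
  have vscale_commute: "vscale x (vscale y v) = vscale y (vscale x v)" for x y and v :: "nat \<Rightarrow> 'a"
    by (simp add: vscale_def mult.left_commute)
  \<comment> \<open>Denominators are cleared: \<open>x\<close> belongs to \<open>K\<close> if x / c
    times the identity lifts to \<open>M\<close>. A lift of the identity itself is therefore the
    statement \<open>c \<in> K\<close>.\<close>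
  define K where "K = {x. \<exists>s. lin s \<and> (\<forall>t\<in>iset I. c * s t m = x * t)}"
  have "r_ideal K"
  proof (rule r_idealI)
    have "lin (\<lambda>_ _. 0)" using submod_zero[OF M] by (auto simp: lin_def vadd_def vscale_def)
    then show "0 \<in> K" unfolding K_def by force
  next
    fix x y assume "x \<in> K" "y \<in> K"
    then obtain s s' where s: "lin s" "\<forall>t\<in>iset I. c * s t m = x * t"
      and s': "lin s'" "\<forall>t\<in>iset I. c * s' t m = y * t" unfolding K_def by blast
    have "lin (\<lambda>t. vadd (s t) (s' t))"
      using s(1) s'(1) M by (auto simp: lin_def submod_add vadd_swap vscale_vadd)
    moreover have "\<forall>t\<in>iset I. c * vadd (s t) (s' t) m = (x + y) * t"
      using s(2) s'(2) by (simp add: vadd_def algebra_simps)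
    ultimately show "x + y \<in> K" unfolding K_def by blast
  next
    fix r x assume "x \<in> K"
    then obtain s where s: "lin s" "\<forall>t\<in>iset I. c * s t m = x * t" unfolding K_def by blast
    have "lin (\<lambda>t. vscale r (s t))"
      using s(1) M vscale_commute by (auto simp: lin_def submod_scale vscale_vadd)
    moreover have "\<forall>t\<in>iset I. c * vscale r (s t) m = (r * x) * t"
      using s(2) by (simp add: vscale_def algebra_simps)
    ultimately show "r * x \<in> K" unfolding K_def by blast
  qed
  then have "ideal_prod (iset I) {b. \<forall>t\<in>iset I. c dvd b * t} \<subseteq> K"
  proof (rule ideal_prod_least)
    fix a b assume a: "a \<in> iset I" and b: "b \<in> {b. \<forall>t\<in>iset I. c dvd b * t}"
    \<comment> \<open>For a preimage \<open>w\<close> of \<open>a\<close>, the map sending t to (b t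
      / c) w lifts ab / c times the identity, and b t / c is an element of the ring by the choice of
      \<open>b\<close>.\<close>
    obtain w where w: "w \<in> M" "w m = a" using a I by auto
    have "\<forall>t\<in>iset I. \<exists>q. b * t = c * q" using b by (auto simp: dvd_def)
    then obtain q where q: "\<And>t. t \<in> iset I \<Longrightarrow> c * q t = b * t" by metis
    have "q (t + t') = q t + q t'" if "t \<in> iset I" "t' \<in> iset I" for t t'
    proof -
      have "c * q (t + t') = c * (q t + q t')"
        using that q[OF r_ideal_add[OF r_ideal_iset that]] by (simp add: distrib_left q)
      then show ?thesis using c(2) by simp
    qed
    moreover have "q (r * t) = r * q t" if "t \<in> iset I" for r t
    proof -
      have "c * q (r * t) = c * (r * q t)"
        using that q[OF r_ideal_mult[OF r_ideal_iset that]] by (simp add: mult.left_commute q)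
      then show ?thesis using c(2) by simp
    qed
    ultimately have "lin (\<lambda>t. vscale (q t) w)"
      using submod_scale[OF M w(1)]
      by (simp add: lin_def) (simp add: vadd_def vscale_def distrib_right mult.assoc)
    moreover have "\<forall>t\<in>iset I. c * vscale (q t) w m = (a * b) * t"
      using q w(2) by (simp add: vscale_def mult.assoc[symmetric])
    ultimately show "a * b \<in> K" unfolding K_def by blast
  qed
  then have "c \<in> K" using ideal_invertible[OF r_ideal_iset c] by blast
  then show ?thesis using c(2) unfolding K_def lin_def by auto
qed

text \<open>Induction on the ambient rank. The last coordinate maps \<open>M\<close> onto an ideal
  with kernel \<open>M \<inter> free_mod m\<close>; a nonzero ideal splits off through a section and
  becomes the last entry of the list, while the zero ideal contributes no entry. The argument covers
  every submodule of a free module, so projectivity is only used through the embedding.\<close>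

lemma submod_free_iso_ideal_dsum:
  assumes "submod M" "M \<subseteq> free_mod m"
  shows "\<exists>L :: 'a nzideal list. mod_iso M (ideal_dsum L)"
  using assms
proof (induction m arbitrary: M)
  case 0
  then have "M \<subseteq> {\<lambda>_. 0}" by (auto simp: free_mod_def)
  moreover have "ideal_dsum [] = {\<lambda>_. 0 :: 'a}" by (auto simp: ideal_dsum_def)
  ultimately have "M = ideal_dsum []" using submod_zero[OF 0(1)] by auto
  then show ?case using mod_iso_refl by blast
next
  case (Suc m)
  let ?I = "(\<lambda>v. v m) ` M"
  have I: "r_ideal ?I"
  proof (rule r_idealI)
    show "0 \<in> ?I" using submod_zero[OF Suc.prems(1)] by force
  next
    fix x y assume "x \<in> ?I" "y \<in> ?I"
    then obtain v w where "v \<in> M" "w \<in> M" "x = v m" "y = w m" by blast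
    then have "vadd v w \<in> M" "x + y = vadd v w m" using submod_add[OF Suc.prems(1)] by (auto simp: vadd_def)
    then show "x + y \<in> ?I" by blast
  next
    fix r x assume "x \<in> ?I"
    then obtain v where "v \<in> M" "x = v m" by blast
    then have "vscale r v \<in> M" "r * x = vscale r v m" using submod_scale[OF Suc.prems(1)] by (auto simp: vscale_def)
    then show "r * x \<in> ?I" by blast
  qed
  let ?A = "M \<inter> free_mod m"
  have A: "submod ?A" using Suc.prems(1) submod_free_mod by (rule submod_Int)
  obtain L :: "'a nzideal list" where L: "mod_iso ?A (ideal_dsum L)" using Suc.IH[OF A] by blast
  show ?case
  proof (cases "?I = {0}")
    case True
    have "v i = 0" if v: "v \<in> M" "i \<ge> m" for v i
    proof (cases "i = m")
      case True
      then show ?thesis using \<open>?I = {0}\<close> v(1) by blast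
    next
      case False
      then show ?thesis using v Suc.prems(2) by (auto simp: free_mod_def)
    qed
    then have "?A = M" by (auto simp: free_mod_def)
    then show ?thesis using L by auto
  next
    case False
    define J where "J = Abs_nzideal ?I"
    have J: "iset J = ?I" unfolding J_def using I False by (intro Abs_nzideal_inverse) simp
    obtain s where s: "\<And>t. t \<in> iset J \<Longrightarrow> s t \<in> M" "\<And>t. t \<in> iset J \<Longrightarrow> s t m = t"
      and s_add: "\<And>t t'. t \<in> iset J \<Longrightarrow> t' \<in> iset J \<Longrightarrow> s (t + t') = vadd (s t) (s t')"
      and s_scale: "\<And>r t. t \<in> iset J \<Longrightarrow> s (r * t) = vscale r (s t)"
      using exists_section[OF Suc.prems(1) J] by blast
    let ?B = "(\<lambda>v. s (v 0)) ` ideal_dsum [J]"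
    have D: "v 0 \<in> iset J" if "v \<in> ideal_dsum [J]" for v using that by (simp add: ideal_dsum_def)
    have lin: "lin_map_on (ideal_dsum [J]) (\<lambda>v. s (v 0))"
      using s_add s_scale D by (auto simp: lin_map_on_def vadd_vscale_simps)
    have inj: "inj_on (\<lambda>v. s (v 0)) (ideal_dsum [J])"
    proof (rule inj_onI)
      fix v w assume vw: "v \<in> ideal_dsum [J]" "w \<in> ideal_dsum [J]" "s (v 0) = s (w 0)"
      have "v 0 = w 0" using s(2)[OF D[OF vw(1)]] s(2)[OF D[OF vw(2)]] fun_cong[OF vw(3), of m] by metis
      moreover have "v i = 0" "w i = 0" if "i \<noteq> 0" for i using vw that by (auto simp: ideal_dsum_def)
      ultimately have "v i = w i" for i by (cases "i = 0") simp_all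
      then show "v = w" by (rule ext)
    qed
    have sB: "s t \<in> ?B" if "t \<in> iset J" for t
      by (rule image_eqI[of _ _ "single_vec 0 t"])
        (use that in \<open>auto simp: single_vec_def ideal_dsum_def\<close>)
    have "internal_sum M ?A ?B"
      unfolding internal_sum_def
    proof (intro conjI A submod_image[OF lin submod_ideal_dsum] equalityI subsetI)
      fix x assume "x \<in> ?A \<inter> ?B"
      then obtain t where t: "t \<in> iset J" "x = s t" "x m = 0" using D by (auto simp: free_mod_def)
      then have "t = 0" using s(2) by simp
      then have "x = s (0 * t)" using t by simp
      also have "\<dots> = (\<lambda>_. 0)" using s_scale[OF t(1), of 0] by (simp add: vscale_def)
      finally show "x \<in> {\<lambda>_. 0}" by simp
    next
      fix x :: "nat \<Rightarrow> 'a" assume "x \<in> {\<lambda>_. 0}"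
      then show "x \<in> ?A \<inter> ?B"
        using submod_zero[OF A] submod_zero[OF submod_image[OF lin submod_ideal_dsum]] by blast
    next
      fix x assume "x \<in> {vadd v w |v w. v \<in> ?A \<and> w \<in> ?B}"
      then show "x \<in> M" using s(1) D submod_add[OF Suc.prems(1)] by blast
    next
      fix x assume x: "x \<in> M"
      then have t: "x m \<in> iset J" using J by blast
      define y where "y = (\<lambda>i. x i - s (x m) i)"
      have "y \<in> M" unfolding y_def using submod_diff[OF Suc.prems(1) x s(1)[OF t]] .
      moreover have "y i = 0" if "i \<ge> m" for i
      proof (cases "i = m")
        case True
        then show ?thesis using s(2)[OF t] by (simp add: y_def)
      next
        case False
        then show ?thesis using \<open>y \<in> M\<close> that Suc.prems(2) by (auto simp: free_mod_def)
      qed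
      ultimately have "y \<in> ?A" by (simp add: free_mod_def)
      moreover have "x = vadd y (s (x m))" by (simp add: y_def vadd_def)
      ultimately show "x \<in> {vadd v w |v w. v \<in> ?A \<and> w \<in> ?B}" using sB[OF t] by blast
    qed
    moreover have "mod_iso ?B (ideal_dsum [J])"
      by (rule mod_iso_sym[OF mod_iso_image[OF lin inj] submod_ideal_dsum])
    ultimately have "mod_iso M (ideal_dsum (L @ [J]))"
      using L mod_iso_ideal_dsum_append_iff[OF Suc.prems(1)] by blast
    then show ?thesis by blast
  qed
qed

end

subsection \<open>Counting solutions of a linear congruence\<close>

lemma card_bounded_functions:
  assumes "finite (S :: nat set)" "p > (0::nat)"
  shows "card {e. (\<forall>i. i \<notin> S \<longrightarrow> e i = 0) \<and> (\<forall>i. e i < p)} = p ^ card S"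
    and "finite {e. (\<forall>i. i \<notin> S \<longrightarrow> e i = 0) \<and> (\<forall>i. e i < p)}"
proof -
  let ?F = "{e. (\<forall>i. i \<notin> S \<longrightarrow> e i = 0) \<and> (\<forall>i. e i < p)}"
  have bij: "bij_betw (\<lambda>e. restrict e S) ?F (PiE S (\<lambda>_. {..<p}))"
  proof (rule bij_betwI[where g = "\<lambda>e i. if i \<in> S then e i else 0"])
    show "(\<lambda>e i. if i \<in> S then e i else 0) \<in> (PiE S (\<lambda>_. {..<p})) \<rightarrow> ?F"
      using assms(2) by (auto simp: PiE_def)
  qed (auto simp: fun_eq_iff PiE_def extensional_def restrict_def)
  show "card ?F = p ^ card S"
    using bij_betw_same_card[OF bij] card_PiE[OF assms(1), of "\<lambda>_. {..<p}"] by simp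
  show "finite ?F"
    using bij_betw_finite[OF bij] finite_PiE[OF assms(1), of "\<lambda>_. {..<p}"] by simp
qed

lemma ex_solution_mod_prime:
  assumes "prime (p::nat)" "\<not> p dvd a"
  shows "\<exists>x<p. p dvd a * x + s"
proof -
  have p0: "p > 0" using assms(1) by (simp add: prime_gt_0_nat)
  have "coprime a p" using assms prime_imp_coprime coprime_commute by blast
  then obtain y where "[a * y = 1] (mod p)" using cong_solve_coprime_nat by auto
  \<comment> \<open>Within the natural numbers, -s is represented by \<open>s * (p - 1)\<close>
    modulo \<open>p\<close>, so the solution is the inverse \<open>y\<close> of \<open>a\<close>
    times this number.\<close>
  then have "[a * y * (s * (p - 1)) + s = 1 * (s * (p - 1)) + s] (mod p)"
    by (intro cong_add cong_mult cong_refl)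
  also have "1 * (s * (p - 1)) + s = s * p" using p0 by (cases p) simp_all
  also have "[s * p = 0] (mod p)" by (simp add: cong_0_iff)
  finally have *: "[a * (y * (s * (p - 1))) + s = 0] (mod p)" by (simp add: mult.assoc)
  have "[a * ((y * (s * (p - 1))) mod p) + s = a * (y * (s * (p - 1))) + s] (mod p)"
    by (intro cong_add cong_mult cong_refl) simp
  then have "p dvd a * ((y * (s * (p - 1))) mod p) + s" using * by (metis cong_0_iff cong_trans)
  moreover have "(y * (s * (p - 1))) mod p < p" using p0 by simp
  ultimately show ?thesis by blast
qed

lemma unique_solution_mod_prime:
  assumes "prime (p::nat)" "\<not> p dvd a" "x < p" "y < p" "p dvd a * x + s" "p dvd a * y + s"
  shows "x = y"
proof -
  have "coprime a p" using assms(1,2) prime_imp_coprime coprime_commute by blast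
  moreover have "[a * x + s = a * y + s] (mod p)"
    using assms(5,6) by (simp add: cong_def dvd_eq_mod_eq_0)
  then have "[a * x = a * y] (mod p)" by (simp only: cong_add_rcancel_nat)
  ultimately have "[x = y] (mod p)" by (simp add: cong_mult_lcancel_nat)
  then show ?thesis using assms(3,4) by (simp add: cong_def)
qed

text \<open>If \<open>p\<close> divides all of \<open>S\<close>, the congruence always holds; this
  includes the empty \<open>S\<close>. Otherwise fix \<open>a\<close> in \<open>S\<close> prime to
  \<open>p\<close>: the other values can be chosen freely and determine \<open>e a\<close> uniquely
  below \<open>p\<close>, so erasing \<open>e a\<close> is a bijection onto the functions supported
  on \<open>S - {a}\<close>.\<close>

lemma card_congruence_solutions:
  assumes p: "prime (p::nat)" and S: "finite S"
  shows "card {e. (\<forall>i. i \<notin> S \<longrightarrow> e i = 0) \<and> (\<forall>i. e i < p) \<and> p dvd (\<Sum>i\<in>S. i * e i)} =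
    (if \<forall>i\<in>S. p dvd i then p ^ card S else p ^ (card S - 1))"
proof (cases "\<forall>i\<in>S. p dvd i")
  case True
  then have "p dvd (\<Sum>i\<in>S. i * e i)" for e by (auto intro: dvd_sum)
  then show ?thesis using True card_bounded_functions(1)[OF S] prime_gt_0_nat[OF p] by simp
next
  case False
  then obtain a where a: "a \<in> S" "\<not> p dvd a" by blast
  let ?E = "{e. (\<forall>i. i \<notin> S \<longrightarrow> e i = 0) \<and> (\<forall>i. e i < p) \<and> p dvd (\<Sum>i\<in>S. i * e i)}"
  let ?F = "{e. (\<forall>i. i \<notin> S - {a} \<longrightarrow> e i = 0) \<and> (\<forall>i. e i < p)}"
  have split: "(\<Sum>i\<in>S. i * e i) = a * e a + (\<Sum>i\<in>S - {a}. i * e i)" for e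
    by (rule sum.remove[OF S a(1)])
  have rest: "(\<Sum>i\<in>S - {a}. i * (e(a := x)) i) = (\<Sum>i\<in>S - {a}. i * e i)" for e x
    by (rule sum.cong) auto
  have "bij_betw (\<lambda>e. e(a := 0)) ?E ?F"
  proof (rule bij_betw_imageI)
    show "inj_on (\<lambda>e. e(a := 0)) ?E"
    proof (rule inj_onI)
      fix e d assume e: "e \<in> ?E" and d: "d \<in> ?E" and eq: "e(a := 0) = d(a := 0)"
      have off: "e i = d i" if "i \<noteq> a" for i using fun_cong[OF eq, of i] that by simp
      have "(\<Sum>i\<in>S - {a}. i * e i) = (\<Sum>i\<in>S - {a}. i * d i)" using off by (intro sum.cong) auto
      then have "p dvd a * e a + (\<Sum>i\<in>S - {a}. i * d i)" "p dvd a * d a + (\<Sum>i\<in>S - {a}. i * d i)"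
        using e d split by auto
      then have "e a = d a" using unique_solution_mod_prime[OF p a(2)] e d by blast
      then show "e = d" using off by (metis ext)
    qed
    show "(\<lambda>e. e(a := 0)) ` ?E = ?F"
    proof (intro equalityI subsetI)
      fix f assume "f \<in> (\<lambda>e. e(a := 0)) ` ?E"
      then show "f \<in> ?F" using prime_gt_0_nat[OF p] by auto
    next
      fix f assume f: "f \<in> ?F"
      obtain x where x: "x < p" "p dvd a * x + (\<Sum>i\<in>S - {a}. i * f i)"
        using ex_solution_mod_prime[OF p a(2)] by blast
      have "f(a := x) \<in> ?E" using f x a(1) rest[of f x] by (auto simp: split)
      moreover have "f = (f(a := x))(a := 0)" using f by auto
      ultimately show "f \<in> (\<lambda>e. e(a := 0)) ` ?E" by blast
    qed
  qed
  then have "card ?E = card ?F" by (rule bij_betw_same_card)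
  also have "\<dots> = p ^ (card S - 1)"
    using card_bounded_functions(1)[of "S - {a}" p] S a(1) prime_gt_0_nat[OF p] by simp
  finally show ?thesis by (simp only: False if_False)
qed

lemma finite_part_vecs: "finite (part_vecs n)"
proof (rule finite_subset)
  show "part_vecs n \<subseteq> {z. (\<forall>i. i \<notin> {1..n} \<longrightarrow> z i = 0) \<and> (\<forall>i. z i < Suc n)}"
  proof
    fix z assume z: "z \<in> part_vecs n"
    have "z i \<le> n" for i
    proof (cases "i \<in> {1..n}")
      case True
      then have "z i \<le> i * z i" by simp
      also have "\<dots> \<le> (\<Sum>i=1..n. i * z i)" using True by (intro member_le_sum) auto
      also have "\<dots> = n" using z by (simp add: part_vecs_def)
      finally show ?thesis .
    next
      case False
      then have "z i = 0" using z unfolding part_vecs_def by blast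
      then show ?thesis by simp
    qed
    then show "z \<in> {z. (\<forall>i. i \<notin> {1..n} \<longrightarrow> z i = 0) \<and> (\<forall>i. z i < Suc n)}"
      using z by (auto simp: part_vecs_def less_Suc_eq_le)
  qed
  show "finite {z :: nat \<Rightarrow> nat. (\<forall>i. i \<notin> {1..n} \<longrightarrow> z i = 0) \<and> (\<forall>i. z i < Suc n)}"
    by (rule card_bounded_functions(2)) auto
qed

text \<open>The vectors are grouped by the size \<open>k\<close> of their support. It lies between 1
  and \<open>n\<close>, and it is positive because the weighted sum \<open>n\<close> is.\<close>

lemma sum_part_vecs_by_support:
  assumes "n \<ge> 1"
  shows "(\<Sum>z\<in>part_vecs n. if \<forall>i. z i \<noteq> 0 \<longrightarrow> p dvd i then p ^ card {i. z i \<noteq> 0} else p ^ (card {i. z i \<noteq> 0} - 1)) =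
    (\<Sum>k=1..n. nu_p n k p * p ^ k + nu' n k p * p ^ (k - 1))"
proof -
  let ?k = "\<lambda>z :: nat \<Rightarrow> nat. card {i. z i \<noteq> 0}"
  let ?d = "\<lambda>z :: nat \<Rightarrow> nat. \<forall>i. z i \<noteq> 0 \<longrightarrow> p dvd i"
  let ?h = "\<lambda>z. if ?d z then p ^ ?k z else p ^ (?k z - 1)"
  have k: "?k ` part_vecs n \<subseteq> {1..n}"
  proof
    fix k assume "k \<in> ?k ` part_vecs n"
    then obtain z where z: "z \<in> part_vecs n" "k = ?k z" by blast
    have sub: "{i. z i \<noteq> 0} \<subseteq> {1..n}" using z(1) by (auto simp: part_vecs_def)
    have "{i. z i \<noteq> 0} \<noteq> {}"
    proof
      assume "{i. z i \<noteq> 0} = {}"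
      then have "(\<Sum>i=1..n. i * z i) = 0" by simp
      then show False using z(1) assms by (simp add: part_vecs_def)
    qed
    then have "?k z \<ge> 1" using finite_subset[OF sub] by (simp add: Suc_le_eq card_gt_0_iff)
    moreover have "?k z \<le> n" using card_mono[OF _ sub] by simp
    ultimately show "k \<in> {1..n}" using z(2) by simp
  qed
  have fib: "(\<Sum>z\<in>{z \<in> part_vecs n. ?k z = k}. ?h z) = nu_p n k p * p ^ k + nu' n k p * p ^ (k - 1)" for k
  proof -
    let ?A = "{z \<in> part_vecs n. ?k z = k}"
    let ?B = "{z \<in> part_vecs n. ?k z = k \<and> ?d z}"
    have fin: "finite ?A" using finite_part_vecs by simp
    have BA: "?B \<subseteq> ?A" by blast
    have "(\<Sum>z\<in>?A. ?h z) = (\<Sum>z\<in>?A - ?B. ?h z) + (\<Sum>z\<in>?B. ?h z)"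
      by (rule sum.subset_diff[OF BA fin])
    also have "(\<Sum>z\<in>?A - ?B. ?h z) = (\<Sum>z\<in>?A - ?B. p ^ (k - 1))" by (rule sum.cong) auto
    \<comment> \<open>The truncated subtraction in \<open>nu'\<close> is a genuine difference, as
      \<open>?B \<subseteq> ?A\<close>.\<close>
    also have "\<dots> = nu' n k p * p ^ (k - 1)"
      using card_Diff_subset[OF finite_subset[OF BA fin] BA] by (simp add: nu'_def nu_def nu_p_def)
    also have "(\<Sum>z\<in>?B. ?h z) = (\<Sum>z\<in>?B. p ^ k)" by (rule sum.cong) auto
    also have "\<dots> = nu_p n k p * p ^ k" by (simp add: nu_p_def)
    finally show ?thesis by simp
  qed
  show ?thesis
    using sum.group[OF finite_part_vecs finite_atLeastAtMost k, of ?h] by (simp only: fib)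
qed

subsection \<open>External direct sums and isomorphism classes\<close>

lemma is_dsum_Nil_iff:
  assumes "submod X"
  shows "is_dsum X [] \<longleftrightarrow> X = {\<lambda>_. 0}"
proof
  assume "is_dsum X []"
  then have "\<forall>x\<in>X. x = (\<lambda>_. 0)" unfolding is_dsum_def by auto
  then show "X = {\<lambda>_. 0}" using submod_zero[OF assms] by blast
next
  assume X: "X = {\<lambda>_. 0}"
  have "\<exists>!c :: nat \<Rightarrow> nat \<Rightarrow> 'a. \<forall>j. c j = (\<lambda>_. 0)" by (rule ex1I[of _ "\<lambda>_ _. 0"]) auto
  then show "is_dsum X []" unfolding is_dsum_def by (simp add: X)
qed

text \<open>The condition under the unique existence in \<open>is_dsum\<close>, isolated so that a
  recursion on the number of summands can be stated. The zero padding from \<open>k\<close> on makes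
  the family unique as a total function.\<close>

definition summands :: "(nat \<Rightarrow> (nat \<Rightarrow> 'a::comm_ring_1) set) \<Rightarrow> nat \<Rightarrow> (nat \<Rightarrow> 'a) \<Rightarrow> (nat \<Rightarrow> nat \<Rightarrow> 'a) \<Rightarrow> bool" where
  "summands N k x c \<longleftrightarrow> (\<forall>j<k. c j \<in> N j) \<and> (\<forall>j\<ge>k. c j = (\<lambda>_. 0)) \<and> x = (\<lambda>i. \<Sum>j<k. c j i)"

lemma is_dsum_alt:
  "is_dsum X Ms \<longleftrightarrow> (\<exists>N. (\<forall>j<length Ms. submod (N j) \<and> N j \<subseteq> X \<and> mod_iso (N j) (Ms ! j)) \<and>
     (\<forall>x\<in>X. \<exists>!c. summands N (length Ms) x c))"
  by (simp add: is_dsum_def summands_def)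

lemma summands_Suc:
  "summands N (Suc k) x c \<longleftrightarrow>
    c k \<in> N k \<and> (\<exists>a. summands N k a (c(k := \<lambda>_. 0)) \<and> x = vadd a (c k))"
proof
  assume "summands N (Suc k) x c"
  then show "c k \<in> N k \<and> (\<exists>a. summands N k a (c(k := \<lambda>_. 0)) \<and> x = vadd a (c k))"
    by (intro conjI exI[of _ "\<lambda>i. \<Sum>j<k. c j i"])
      (auto simp: summands_def vadd_def intro!: sum.cong)
next
  assume "c k \<in> N k \<and> (\<exists>a. summands N k a (c(k := \<lambda>_. 0)) \<and> x = vadd a (c k))"
  then obtain a where a: "c k \<in> N k" "summands N k a (c(k := \<lambda>_. 0))" "x = vadd a (c k)" by blast
  have "c j \<in> N j" if "j < k" for j using a(2) that by (auto simp: summands_def dest!: spec[of _ j])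
  moreover have "c j = (\<lambda>_. 0)" if "j \<ge> Suc k" for j
    using a(2) that by (auto simp: summands_def dest!: spec[of _ j])
  moreover have "a = (\<lambda>i. \<Sum>j<k. c j i)"
    using a(2) by (auto simp: summands_def intro!: sum.cong)
  ultimately show "summands N (Suc k) x c"
    using a(1,3) by (auto simp: summands_def vadd_def less_Suc_eq)
qed

lemma summands_cong: "(\<And>j. j < k \<Longrightarrow> N j = N' j) \<Longrightarrow> summands N k x c \<longleftrightarrow> summands N' k x c"
  by (auto simp: summands_def)

text \<open>The complement of the last summand consists of the sums over the others. Existence of
  decompositions makes the two span \<open>X\<close>, and uniqueness makes their intersection
  trivial.\<close>

lemma is_dsum_snocD:
  assumes X: "submod X" and ds: "is_dsum X (Ms @ [M])"
  shows "\<exists>A B. internal_sum X A B \<and> is_dsum A Ms \<and> mod_iso B M"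
proof -
  let ?k = "length Ms"
  obtain N where N': "\<forall>j<Suc ?k. submod (N j) \<and> N j \<subseteq> X \<and> mod_iso (N j) ((Ms @ [M]) ! j)"
    "\<forall>x\<in>X. \<exists>!c. summands N (Suc ?k) x c"
    using ds unfolding is_dsum_alt length_append_singleton by (elim exE conjE)
  have N: "submod (N j)" "N j \<subseteq> X" "mod_iso (N j) ((Ms @ [M]) ! j)" if "j < Suc ?k" for j
    using N'(1) that by blast+
  have ex1: "\<exists>!c. summands N (Suc ?k) x c" if "x \<in> X" for x
    using N'(2) that by (rule bspec)
  define A where "A = {x. \<exists>c. summands N ?k x c}"
  have sumA: "x \<in> A" if "\<And>j. j < ?k \<Longrightarrow> c j \<in> N j" "x = (\<lambda>i. \<Sum>j<?k. c j i)" for x c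
    unfolding A_def summands_def using that
    by (intro CollectI exI[of _ "\<lambda>j. if j < ?k then c j else (\<lambda>_. 0)"]) auto
  have A: "submod A"
    unfolding submod_def
  proof (intro conjI ballI allI)
    show "(\<lambda>_. 0) \<in> A" by (rule sumA[of "\<lambda>_ _. 0"]) (simp_all add: submod_zero N(1))
  next
    fix v w assume "v \<in> A" "w \<in> A"
    then obtain c d where "summands N ?k v c" "summands N ?k w d" unfolding A_def by blast
    then show "vadd v w \<in> A"
      by (intro sumA[of "\<lambda>j. vadd (c j) (d j)"])
        (auto simp: summands_def vadd_def sum.distrib intro: submod_add[OF N(1), unfolded vadd_def])
  next
    fix r v assume "v \<in> A"
    then obtain c where "summands N ?k v c" unfolding A_def by blast
    then show "vscale r v \<in> A"
      by (intro sumA[of "\<lambda>j. vscale r (c j)"])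
        (auto simp: summands_def vscale_def sum_distrib_left intro: submod_scale[OF N(1), unfolded vscale_def])
  qed
  have AX: "A \<subseteq> X"
    unfolding A_def summands_def using N(2)[OF less_SucI] by (auto intro!: submod_sum[OF X] dest: subsetD)
  have lift: "summands N (Suc ?k) x c" if "summands N ?k x c" for x c
  proof -
    have "c ?k = (\<lambda>_. 0)" using that by (simp add: summands_def)
    then have "c(?k := \<lambda>_. 0) = c" by auto
    then show ?thesis
      using that submod_zero[OF N(1)[of ?k]] \<open>c ?k = _\<close>
      by (auto simp: summands_Suc vadd_def)
  qed
  have "A \<inter> N ?k = {\<lambda>_. 0}"
  proof (intro equalityI subsetI)
    fix x assume x: "x \<in> A \<inter> N ?k"
    then obtain c where c: "summands N ?k x c" unfolding A_def by blast
    have z: "summands N ?k (\<lambda>_. 0) (\<lambda>_ _. 0)" using submod_zero[OF N(1)] by (auto simp: summands_def)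
    moreover have "((\<lambda>_ _. 0)(?k := x))(?k := \<lambda>_. 0) = (\<lambda>_ _. 0)" by auto
    \<comment> \<open>An element of the intersection has two decompositions: one with only
      \<open>x\<close> in the last slot, and \<open>c\<close>, whose last slot is zero. Uniqueness
      identifies them, so \<open>x\<close> is zero.\<close>
    ultimately have "summands N (Suc ?k) x ((\<lambda>_ _. 0)(?k := x))"
      unfolding summands_Suc using x by (simp add: exI[of _ "\<lambda>_. 0"] vadd_def)
    moreover have "summands N (Suc ?k) x c" using c by (rule lift)
    ultimately have "c = (\<lambda>_ _. 0)(?k := x)" using ex1 x AX by blast
    then have "c ?k = x" by simp
    moreover have "c ?k = (\<lambda>_. 0)" using c by (simp add: summands_def)
    ultimately show "x \<in> {\<lambda>_. 0}" by simp
  qed (use submod_zero[OF A] submod_zero[OF N(1)] in auto)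
  moreover have "{vadd v w |v w. v \<in> A \<and> w \<in> N ?k} = X"
  proof (intro equalityI subsetI)
    fix x assume "x \<in> {vadd v w |v w. v \<in> A \<and> w \<in> N ?k}"
    then show "x \<in> X" using AX N(2)[of ?k] submod_add[OF X] by blast
  next
    fix x assume "x \<in> X"
    then obtain c where "summands N (Suc ?k) x c" using ex1 by blast
    then show "x \<in> {vadd v w |v w. v \<in> A \<and> w \<in> N ?k}" unfolding summands_Suc A_def by blast
  qed
  ultimately have "internal_sum X A (N ?k)" using A N(1)[of ?k] by (simp add: internal_sum_def)
  moreover have "is_dsum A Ms"
    unfolding is_dsum_alt
  proof (intro exI[of _ N] conjI allI impI ballI)
    fix j assume j: "j < ?k"
    show "submod (N j)" using N(1) j by simp
    show "mod_iso (N j) (Ms ! j)" using N(3)[of j] j by (simp add: nth_append)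
    show "N j \<subseteq> A"
    proof
      fix x assume "x \<in> N j"
      then show "x \<in> A"
        by (intro sumA[of "\<lambda>l. if l = j then x else (\<lambda>_. 0)"])
          (use j in \<open>auto simp: if_distribR submod_zero N(1)\<close>)
    qed
  next
    fix x assume x: "x \<in> A"
    then obtain c where "summands N ?k x c" unfolding A_def by blast
    moreover have "d = c" if "summands N ?k x d" for d
      using lift[OF that] lift[OF \<open>summands N ?k x c\<close>] ex1 x AX by blast
    ultimately show "\<exists>!c. summands N ?k x c" by blast
  qed
  moreover have "mod_iso (N ?k) M" using N(3)[of ?k] by simp
  ultimately show ?thesis by blast
qed

text \<open>The last component of a decomposition is forced by the splitting into \<open>A\<close>
  and \<open>B\<close>, the remaining ones by the uniqueness inside \<open>A\<close>.\<close>

lemma is_dsum_snocI: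
  assumes X: "internal_sum X A B" and ds: "is_dsum A Ms" and iso: "mod_iso B M"
  shows "is_dsum X (Ms @ [M])"
proof -
  let ?k = "length Ms"
  note AB = internal_sum_submods[OF X]
  obtain N where N': "\<forall>j<?k. submod (N j) \<and> N j \<subseteq> A \<and> mod_iso (N j) (Ms ! j)"
    "\<forall>x\<in>A. \<exists>!c. summands N ?k x c"
    using ds unfolding is_dsum_alt by (elim exE conjE)
  have N: "submod (N j)" "N j \<subseteq> A" "mod_iso (N j) (Ms ! j)" if "j < ?k" for j
    using N'(1) that by blast+
  have ex1: "\<exists>!c. summands N ?k x c" if "x \<in> A" for x
    using N'(2) that by (rule bspec)
  define N' where "N' = N(?k := B)"
  have eqk: "summands N' ?k a c \<longleftrightarrow> summands N ?k a c" for a c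
    by (rule summands_cong) (simp add: N'_def)
  have inA: "a \<in> A" if "summands N ?k a c" for a c
    using that N(2) unfolding summands_def by (auto intro!: submod_sum[OF AB(1)])
  have *: "summands N' (Suc ?k) x c \<longleftrightarrow>
    c ?k \<in> B \<and> (\<exists>a. summands N ?k a (c(?k := \<lambda>_. 0)) \<and> x = vadd a (c ?k))" for x c
    unfolding summands_Suc eqk by (simp add: N'_def)
  show ?thesis
    unfolding is_dsum_alt
  proof (intro exI[of _ N'] conjI allI impI ballI)
    fix j assume j: "j < length (Ms @ [M])"
    show "submod (N' j)" "N' j \<subseteq> X" "mod_iso (N' j) ((Ms @ [M]) ! j)"
      using j N AB iso internal_sum_subset[OF X]
      by (auto simp: N'_def nth_append less_Suc_eq dest!: subsetD)
  next
    fix x assume "x \<in> X"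
    then obtain a b where ab: "a \<in> A" "b \<in> B" "x = vadd a b" by (rule internal_sum_memE[OF X])
    obtain c where c: "summands N ?k a c" and uniq: "\<And>d. summands N ?k a d \<Longrightarrow> d = c"
      using ex1[OF ab(1)] by blast
    have ck: "c(?k := \<lambda>_. 0) = c" using c by (auto simp: summands_def)
    have "\<exists>!c. summands N' (Suc ?k) x c"
    proof (rule ex1I)
      show "summands N' (Suc ?k) x (c(?k := b))"
        unfolding * using c ab ck by auto
    next
      fix d assume "summands N' (Suc ?k) x d"
      then obtain a' where d: "d ?k \<in> B" "summands N ?k a' (d(?k := \<lambda>_. 0))" "x = vadd a' (d ?k)"
        unfolding * by blast
      have "a = a'" "b = d ?k"
        using internal_sum_unique[OF X ab(1) inA[OF d(2)] ab(2) d(1)] ab(3) d(3) by simp_all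
      then have "d(?k := \<lambda>_. 0) = c" using uniq d(2) by simp
      then show "d = c(?k := b)" using \<open>b = d ?k\<close> by (metis fun_upd_triv fun_upd_upd)
    qed
    then show "\<exists>!c. summands N' (length (Ms @ [M])) x c" by simp
  qed
qed

text \<open>Both sides split off their last summand in the same way, which suggests induction from
  the right; the lists of ideals may have any lengths.\<close>

lemma is_dsum_iff_ideal_dsum:
  fixes X :: "(nat \<Rightarrow> 'a::idom) set"
  assumes "submod X" "list_all2 (\<lambda>M L. submod M \<and> mod_iso M (ideal_dsum L)) Ms Ls"
  shows "is_dsum X Ms \<longleftrightarrow> mod_iso X (ideal_dsum (concat Ls))"
  using assms
proof (induction Ms arbitrary: X Ls rule: rev_induct)
  case Nil
  have D: "ideal_dsum [] = {\<lambda>_. 0 :: 'a}" by (auto simp: ideal_dsum_def)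
  have "X = {\<lambda>_. 0}" if iso: "mod_iso X {\<lambda>_. 0}"
  proof -
    obtain f where f: "bij_betw f X {\<lambda>_::nat. 0 :: 'a}" using iso unfolding mod_iso_def by blast
    have "x = (\<lambda>_. 0)" if x: "x \<in> X" for x
    proof (rule inj_onD[OF bij_betw_imp_inj_on[OF f]])
      show "f x = f (\<lambda>_. 0)" using bij_betwE[OF f] x submod_zero[OF Nil(1)] by simp
    qed (use x submod_zero[OF Nil(1)] in simp_all)
    then show ?thesis using submod_zero[OF Nil(1)] by blast
  qed
  then show ?case using Nil is_dsum_Nil_iff[OF Nil(1)] mod_iso_refl by (auto simp: D)
next
  case (snoc M Ms)
  obtain Ls' L where Ls: "Ls = Ls' @ [L]"
    "list_all2 (\<lambda>M L. submod M \<and> mod_iso M (ideal_dsum L)) Ms Ls'"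
    and M: "submod M" "mod_iso M (ideal_dsum L)"
    using snoc.prems(2) by (auto simp: list_all2_append1 list_all2_Cons1)
  have isoM: "mod_iso B M \<longleftrightarrow> mod_iso B (ideal_dsum L)" for B
    using mod_iso_trans M mod_iso_sym by blast
  have "is_dsum X (Ms @ [M]) \<longleftrightarrow> (\<exists>A B. internal_sum X A B \<and> is_dsum A Ms \<and> mod_iso B M)"
    using is_dsum_snocD[OF snoc.prems(1)] is_dsum_snocI by blast
  also have "\<dots> \<longleftrightarrow> (\<exists>A B. internal_sum X A B \<and> mod_iso A (ideal_dsum (concat Ls')) \<and> mod_iso B (ideal_dsum L))"
    using snoc.IH[OF _ Ls(2)] internal_sum_submods(1) isoM by metis
  also have "\<dots> \<longleftrightarrow> mod_iso X (ideal_dsum (concat Ls))"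
    using mod_iso_ideal_dsum_append_iff[OF snoc.prems(1)] Ls(1) by simp
  finally show ?case .
qed

section \<open>Projective modules, their isomorphism classes, and the class group\<close>

lemma fg_proj_iff_internal_sum: "fg_proj P \<longleftrightarrow> (\<exists>m Q. internal_sum (free_mod m) P Q)"
proof
  assume "\<exists>m Q. internal_sum (free_mod m) P Q"
  then obtain m Q where Q: "internal_sum (free_mod m) P Q" by blast
  show "fg_proj P"
    unfolding fg_proj_def using Q internal_sum_subset[OF Q]
    by (intro exI[of _ m] exI[of _ Q]) (simp add: internal_sum_def)
qed (auto simp: fg_proj_def internal_sum_def)

lemma submod_fg_proj: "fg_proj P \<Longrightarrow> submod P"
  by (auto simp: fg_proj_def)

text \<open>The model \<open>ideal_dsum L\<close> need not satisfy \<open>fg_proj\<close> itself: a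
  proper nonzero ideal of a domain is isomorphic to a summand of a free module when it is
  invertible, but is no literal summand of the ring. Hence the class collects the genuine summands
  isomorphic to the model.\<close>

definition module_class :: "'a::idom nzideal list \<Rightarrow> (nat \<Rightarrow> 'a) set set" where
  "module_class L = {Q. fg_proj Q \<and> mod_iso Q (ideal_dsum L)}"

lemma iso_class_eq_module_class:
  assumes "fg_proj P" "mod_iso P (ideal_dsum L)"
  shows "iso_class P = module_class L"
  unfolding iso_class_def module_class_def
  using assms mod_iso_sym mod_iso_trans submod_fg_proj by blast

definition ideal_class :: "'a::idom nzideal \<Rightarrow> 'a nzideal set" where
  "ideal_class I = {J. ideal_equiv I J}"

lemma ideal_class_eq_iff: "ideal_class I = ideal_class J \<longleftrightarrow> ideal_equiv I J"
  unfolding ideal_class_def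
  by (metis (mono_tags, lifting) Collect_cong ideal_equiv_refl ideal_equiv_sym ideal_equiv_trans mem_Collect_eq)

context dedekind
begin

text \<open>Adding an ideal of the inverse class makes the model free; the part of this free module
  that corresponds to \<open>L\<close> is a literal summand. In particular no
  \<open>module_class\<close> is empty.\<close>

lemma ex_fg_proj_iso_ideal_dsum: "\<exists>P. fg_proj P \<and> mod_iso P (ideal_dsum (L :: 'a nzideal list))"
proof -
  obtain J where "ideal_equiv (prod_list L * J) 1" using ideal_equiv_inverse by blast
  then have "mod_iso (free_mod (Suc (length L))) (ideal_dsum (L @ [J]))"
    by (simp add: mod_iso_free_mod_iff)
  then show ?thesis
    using mod_iso_ideal_dsum_append_iff[OF submod_free_mod] fg_proj_iff_internal_sum by blast
qed

lemma fg_proj_iso_ideal_dsum: "fg_proj P \<Longrightarrow> \<exists>L :: 'a nzideal list. mod_iso P (ideal_dsum L)"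
  using submod_free_iso_ideal_dsum unfolding fg_proj_def by blast

lemma fgp_classes_eq: "fgp_classes TYPE('a) = range module_class"
proof (intro equalityI subsetI)
  fix C assume "C \<in> fgp_classes TYPE('a)"
  then obtain P where "fg_proj P" "C = iso_class P" unfolding fgp_classes_def by blast
  then show "C \<in> range module_class"
    using fg_proj_iso_ideal_dsum iso_class_eq_module_class by blast
next
  fix C :: "(nat \<Rightarrow> 'a) set set" assume "C \<in> range module_class"
  then obtain L where L: "C = module_class L" by blast
  obtain P where "fg_proj P" "mod_iso P (ideal_dsum L)" using ex_fg_proj_iso_ideal_dsum by blast
  then show "C \<in> fgp_classes TYPE('a)"
    unfolding fgp_classes_def using iso_class_eq_module_class L by blast
qed

lemma pic_classes_eq: "pic_classes TYPE('a) = range (\<lambda>I. module_class [I])"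
proof (intro equalityI subsetI)
  fix C assume "C \<in> pic_classes TYPE('a)"
  then obtain P where P: "fg_proj P" "mod_rank P = 1" "C = iso_class P" unfolding pic_classes_def by blast
  obtain L where L: "mod_iso P (ideal_dsum L)" using fg_proj_iso_ideal_dsum[OF P(1)] by blast
  then have "length L = 1" using mod_rank_eq_length[OF submod_fg_proj[OF P(1)]] P(2) by simp
  then obtain I where "L = [I]" by (auto simp: length_Suc_conv)
  then show "C \<in> range (\<lambda>I. module_class [I])"
    using L P iso_class_eq_module_class by blast
next
  fix C :: "(nat \<Rightarrow> 'a) set set" assume "C \<in> range (\<lambda>I. module_class [I])"
  then obtain I where I: "C = module_class [I]" by blast
  obtain P where P: "fg_proj P" "mod_iso P (ideal_dsum [I])" using ex_fg_proj_iso_ideal_dsum by blast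
  then have "mod_rank P = 1" using mod_rank_eq_length[OF submod_fg_proj] by force
  then show "C \<in> pic_classes TYPE('a)"
    unfolding pic_classes_def using iso_class_eq_module_class P I by blast
qed

lemma module_class_eq_iff:
  fixes L M :: "'a nzideal list"
  shows "module_class L = module_class M \<longleftrightarrow> length L = length M \<and> ideal_equiv (prod_list L) (prod_list M)"
proof -
  obtain P where P: "fg_proj P" "mod_iso P (ideal_dsum L)" using ex_fg_proj_iso_ideal_dsum by blast
  have "module_class L = module_class M \<longleftrightarrow> mod_iso (ideal_dsum L) (ideal_dsum M)"
  proof
    assume "module_class L = module_class M"
    then have "mod_iso P (ideal_dsum M)" using P unfolding module_class_def by blast
    then show "mod_iso (ideal_dsum L) (ideal_dsum M)"
      using P(2) mod_iso_sym[OF P(2) submod_fg_proj[OF P(1)]] mod_iso_trans by blast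
  next
    assume iso: "mod_iso (ideal_dsum L) (ideal_dsum M)"
    then have "mod_iso P (ideal_dsum M)" using P(2) mod_iso_trans by blast
    then show "module_class L = module_class M" using P iso_class_eq_module_class by blast
  qed
  then show ?thesis by (simp add: mod_iso_ideal_dsum_iff)
qed

text \<open>The assumption on the Picard group enters through its number of elements, so a bijection
  with the ideal classes suffices, and the group law can be taken from multiplication of
  ideals.\<close>

lemma card_pic_classes: "card (pic_classes TYPE('a)) = card (range (ideal_class :: 'a nzideal \<Rightarrow> _))"
proof -
  define h where "h X = module_class [SOME I. I \<in> X]" for X :: "'a nzideal set"
  have h: "h (ideal_class I) = module_class [I]" for I
  proof -
    have "(SOME J. J \<in> ideal_class I) \<in> ideal_class I"
      by (rule someI[of _ I]) (simp add: ideal_class_def)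
    then have "ideal_equiv (SOME J. J \<in> ideal_class I) I" by (metis ideal_class_def ideal_equiv_sym mem_Collect_eq)
    then show ?thesis by (simp add: h_def module_class_eq_iff)
  qed
  have "inj_on h (range ideal_class)"
  proof (rule inj_onI)
    fix X Y assume "X \<in> range ideal_class" "Y \<in> range ideal_class" and eq: "h X = h Y"
    then obtain I J where "X = ideal_class I" "Y = ideal_class J" by blast
    then show "X = Y" using eq by (simp add: h module_class_eq_iff ideal_class_eq_iff)
  qed
  moreover have "h ` range ideal_class = pic_classes TYPE('a)"
    by (auto simp: pic_classes_eq h image_image)
  ultimately show ?thesis by (metis card_image)
qed

text \<open>The group record gives access to element orders and Lagrange's theorem. Products are
  formed through chosen representatives, which is harmless because \<open>ideal_equiv\<close> is a
  congruence.\<close>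

definition class_group :: "'a nzideal set monoid" where
  "class_group = \<lparr>carrier = range ideal_class,
     mult = (\<lambda>X Y. ideal_class ((SOME I. I \<in> X) * (SOME J. J \<in> Y))), one = ideal_class 1\<rparr>"

lemma mult_class_group: "mult class_group (ideal_class I) (ideal_class J) = ideal_class (I * J)"
proof -
  have *: "(SOME J. J \<in> ideal_class I) \<in> ideal_class I" for I :: "'a nzideal"
    by (rule someI[of _ I]) (simp add: ideal_class_def)
  then have "ideal_equiv (SOME J. J \<in> ideal_class I) I" for I :: "'a nzideal"
    by (metis ideal_class_def ideal_equiv_sym mem_Collect_eq)
  then show ?thesis by (simp add: class_group_def ideal_class_eq_iff ideal_equiv_mult)
qed

lemma carrier_class_group: "carrier class_group = range ideal_class"
  and one_class_group: "one class_group = ideal_class 1"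
  by (simp_all add: class_group_def)

lemma group_class_group: "group class_group"
proof (rule groupI)
  fix X assume "X \<in> carrier class_group"
  then obtain I where I: "X = ideal_class I" by (auto simp: carrier_class_group)
  obtain J where "ideal_equiv (I * J) 1" using ideal_equiv_inverse by blast
  then have "mult class_group (ideal_class J) X = one class_group"
    by (simp add: I mult_class_group one_class_group ideal_class_eq_iff mult.commute)
  then show "\<exists>Y\<in>carrier class_group. mult class_group Y X = one class_group"
    by (auto simp: carrier_class_group)
qed (auto simp: carrier_class_group one_class_group mult_class_group mult.assoc)

lemma pow_class_group: "pow class_group (ideal_class I) (k::nat) = ideal_class (I ^ k)"
proof -
  interpret group class_group by (rule group_class_group)
  show ?thesis
    by (induction k) (simp_all add: one_class_group mult_class_group mult.commute)
qed

text \<open>In a group of prime order every element other than the identity has order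
  \<open>p\<close>, so its first \<open>p\<close> powers are distinct and exhaust the group.\<close>

lemma class_group_generator:
  assumes p: "prime p" and card: "card (range (ideal_class :: 'a nzideal \<Rightarrow> _)) = p"
  shows "\<exists>g :: 'a nzideal. (\<forall>I. \<exists>k<p. ideal_equiv I (g ^ k)) \<and>
    (\<forall>k<p. \<forall>l<p. ideal_equiv (g ^ k) (g ^ l) \<longrightarrow> k = l) \<and>
    (\<forall>k. ideal_equiv (g ^ k) 1 \<longleftrightarrow> p dvd k)"
proof -
  interpret group class_group by (rule group_class_group)
  have ord_p: "order class_group = p" by (simp add: order_def carrier_class_group card)
  \<comment> \<open>An infinite set has cardinality 0 by convention, which a prime is not.\<close>
  have fin: "finite (carrier class_group)"
    using card prime_gt_0_nat[OF p] by (metis carrier_class_group card.infinite less_irrefl)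
  obtain X where X: "X \<in> carrier class_group" "X \<noteq> one class_group"
  proof -
    have "\<not> carrier class_group \<subseteq> {one class_group}"
    proof
      assume "carrier class_group \<subseteq> {one class_group}"
      then have "card (carrier class_group) \<le> card {one class_group}" by (intro card_mono) simp_all
      then show False using card prime_gt_1_nat[OF p] by (simp add: carrier_class_group)
    qed
    then show ?thesis using that by blast
  qed
  obtain g where g: "X = ideal_class g" using X(1) by (auto simp: carrier_class_group)
  have "ord X dvd p" using ord_dvd_group_order[OF X(1)] ord_p by simp
  moreover have "ord X \<noteq> 1" using X ord_eq_1 by simp
  ultimately have ordX: "ord X = p" using p by (metis prime_nat_iff)
  have inj: "k = l" if "k < p" "l < p" "ideal_equiv (g ^ k) (g ^ l)" for k l
  proof -
    have "pow class_group X k = pow class_group X l"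
      using that(3) by (simp add: g pow_class_group ideal_class_eq_iff)
    moreover have "inj_on (\<lambda>x. pow class_group X x) {0..ord X - 1}" by (rule ord_inj[OF X(1)])
    ultimately show ?thesis using that ordX by (auto simp: inj_on_def)
  qed
  have "(\<lambda>k. ideal_class (g ^ k)) ` {..<p} = range ideal_class"
  proof (rule card_subset_eq)
    show "finite (range (ideal_class :: 'a nzideal \<Rightarrow> _))" using fin by (simp add: carrier_class_group)
    have "inj_on (\<lambda>k. ideal_class (g ^ k)) {..<p}"
      using inj by (auto simp: inj_on_def ideal_class_eq_iff)
    then show "card ((\<lambda>k. ideal_class (g ^ k)) ` {..<p}) = card (range (ideal_class :: 'a nzideal \<Rightarrow> _))"
      by (simp add: card_image card)
  qed auto
  then have "\<exists>k<p. ideal_equiv I (g ^ k)" for I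
    unfolding ideal_class_eq_iff[symmetric] by (metis (no_types, lifting) imageE lessThan_iff rangeI)
  moreover have "ideal_equiv (g ^ k) 1 \<longleftrightarrow> p dvd k" for k
    using pow_eq_id[OF X(1), of k] by (simp add: g pow_class_group one_class_group ideal_class_eq_iff ordX[unfolded g])
  ultimately show ?thesis using inj by blast
qed

end

section \<open>Admissible tuples of classes and their number\<close>

context dedekind
begin

text \<open>The right-hand side does not mention \<open>reps\<close>, so the existential choice of
  representatives in \<open>fe\<close> can be made arbitrarily. Repeating a list \<open>i\<close>
  times multiplies its length by \<open>i\<close> and raises its product to the power
  \<open>i\<close>.\<close>

lemma is_dsum_module_class_iff:
  fixes L :: "nat \<Rightarrow> 'a nzideal list"
  assumes "\<And>i. i \<in> {1..n} \<Longrightarrow> reps i \<in> module_class (L i)"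
  shows "is_dsum (free_mod n) (concat (map (\<lambda>i. replicate i (reps i)) [1..<Suc n])) \<longleftrightarrow>
    (\<Sum>i=1..n. i * length (L i)) = n \<and> ideal_equiv (\<Prod>i=1..n. prod_list (L i) ^ i) 1"
proof -
  define Ls where "Ls = concat (map (\<lambda>i. replicate i (L i)) [1..<Suc n])"
  have all2: "list_all2 (\<lambda>M L. submod M \<and> mod_iso M (ideal_dsum L))
      (concat (map (\<lambda>i. replicate i (reps i)) is)) (concat (map (\<lambda>i. replicate i (L i)) is))"
    if "set is \<subseteq> {1..n}" for "is"
    using that
  proof (induction "is")
    case (Cons i "is")
    then have "reps i \<in> module_class (L i)" using assms by auto
    then have "submod (reps i)" "mod_iso (reps i) (ideal_dsum (L i))"
      by (auto simp: module_class_def submod_fg_proj)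
    then have "list_all2 (\<lambda>M L. submod M \<and> mod_iso M (ideal_dsum L)) (replicate i (reps i)) (replicate i (L i))"
      by (simp add: list_all2_conv_all_nth)
    then show ?case using Cons by (simp add: list_all2_appendI)
  qed simp
  have "is_dsum (free_mod n) (concat (map (\<lambda>i. replicate i (reps i)) [1..<Suc n])) \<longleftrightarrow>
      mod_iso (free_mod n) (ideal_dsum (concat Ls))"
    unfolding Ls_def by (intro is_dsum_iff_ideal_dsum submod_free_mod all2) (simp only: set_upt, auto)
  moreover have "length (concat Ls) = (\<Sum>i=1..n. i * length (L i))"
    unfolding Ls_def
    by (induction n) (simp_all add: length_concat sum_list_replicate)
  moreover have "prod_list (concat Ls) = (\<Prod>i=1..n. prod_list (L i) ^ i)"
  proof -
    have "prod_list (concat (replicate i K)) = prod_list K ^ i" for i and K :: "'a nzideal list"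
      by (induction i) simp_all
    then show ?thesis unfolding Ls_def by (induction n) (simp_all add: mult.commute)
  qed
  ultimately show ?thesis by (simp add: mod_iso_free_mod_iff)
qed

end

theorem mainTheorem8:
  fixes p n :: nat
  assumes "dedekind_domain TYPE('a::idom)"
    and "prime p"
    and "card (pic_classes TYPE('a)) = p"
    and "n \<ge> 1"
  shows "fe (free_mod n :: (nat \<Rightarrow> 'a) set) =
           (\<Sum>k=1..n. nu_p n k p * p ^ k + nu' n k p * p ^ (k - 1))"
proof -
  interpret dedekind "TYPE('a)" by unfold_locales (rule assms(1))
  obtain g :: "'a nzideal" where ex: "\<And>I. \<exists>k<p. ideal_equiv I (g ^ k)"
    and inj: "\<And>k l. k < p \<Longrightarrow> l < p \<Longrightarrow> ideal_equiv (g ^ k) (g ^ l) \<Longrightarrow> k = l"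
    and triv: "\<And>k. ideal_equiv (g ^ k) 1 \<longleftrightarrow> p dvd k"
    using class_group_generator[OF assms(2)] assms(3) card_pic_classes by metis
  \<comment> \<open>A normal form for every class: rank \<open>z\<close> and Steinitz class
    \<open>g ^ e\<close>. For \<open>z = 0\<close> the list ignores \<open>e\<close>, so
    \<open>ok\<close> fixes \<open>e = 0\<close> there to keep the parameters unique.\<close>
  define L where "L z e = (if z = 0 then [] else g ^ e # replicate (z - 1) 1)" for z e :: nat
  define ok where "ok z e \<longleftrightarrow> e < p \<and> (z = 0 \<longrightarrow> e = 0)" for z e :: nat
  have len: "length (L z e) = z" for z e by (simp add: L_def)
  have prod: "prod_list (L z e) = g ^ e" if "ok z e" for z e
    using that by (simp add: L_def ok_def prod_list_replicate)
  have class_inj: "z = z' \<and> e = e'"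
    if "ok z e" "ok z' e'" "module_class (L z e) = module_class (L z' e')" for z e z' e'
    using that inj by (auto simp: module_class_eq_iff len prod ok_def)
  have class_surj: "\<exists>z e. ok z e \<and> C = module_class (L z e)" if C: "C \<in> fgp_classes TYPE('a)" for C
  proof -
    obtain M where M: "C = module_class M" using C by (auto simp: fgp_classes_eq)
    show ?thesis
    proof (cases "M = []")
      case True
      have "ok 0 0" using assms(2) by (simp add: ok_def prime_gt_0_nat)
      moreover have "L 0 0 = M" by (simp add: L_def True)
      ultimately show ?thesis using M by metis
    next
      case False
      obtain e where e: "e < p" "ideal_equiv (prod_list M) (g ^ e)" using ex by blast
      have "ok (length M) e" using e False by (simp add: ok_def)
      moreover from this have "C = module_class (L (length M) e)"
        using e by (simp add: M module_class_eq_iff len prod)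
      ultimately show ?thesis by blast
    qed
  qed
  \<comment> \<open>For a fixed rank vector \<open>z\<close>, these are the admissible exponent
    vectors, in the form required by \<open>card_congruence_solutions\<close> for the support of
    \<open>z\<close>.\<close>
  define E where "E z = {e. (\<forall>i. i \<notin> {i. z i \<noteq> 0} \<longrightarrow> e i = 0) \<and> (\<forall>i. e i < p) \<and>
    p dvd (\<Sum>i\<in>{i. z i \<noteq> 0}. i * e i)}" for z :: "nat \<Rightarrow> nat"
  \<comment> \<open>Outside \<open>{1..n}\<close> the value is the empty set, matching the padding
    of tuples in \<open>fe\<close>.\<close>
  define \<Phi> where "\<Phi> = (\<lambda>(z :: nat \<Rightarrow> nat, e :: nat \<Rightarrow> nat) i.
    if i \<in> {1..n} then module_class (L (z i) (e i)) else {})"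
  define W where "W = {Z :: nat \<Rightarrow> (nat \<Rightarrow> 'a) set set.
      (\<forall>i\<in>{1..n}. Z i \<in> fgp_classes TYPE('a)) \<and> (\<forall>i. i \<notin> {1..n} \<longrightarrow> Z i = {}) \<and>
      (\<exists>reps. (\<forall>i\<in>{1..n}. reps i \<in> Z i) \<and>
         is_dsum (free_mod n) (concat (map (\<lambda>i. replicate i (reps i)) [1..<Suc n])))}"
  have supp: "finite {i. z i \<noteq> 0}" "{i. z i \<noteq> 0} \<subseteq> {1..n}" if "z \<in> part_vecs n" for z
  proof -
    show "{i. z i \<noteq> 0} \<subseteq> {1..n}" using that by (auto simp: part_vecs_def)
    then show "finite {i. z i \<noteq> 0}" by (rule finite_subset) simp
  qed
  have E_ok: "ok (z i) (e i)" if "e \<in> E z" for z e i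
    using that by (auto simp: E_def ok_def)
  \<comment> \<open>This reconciles the sum over the support used in \<open>E\<close> with the sum
    over all indices produced by the product of the ideals.\<close>
  have sum_supp: "(\<Sum>i\<in>{i. z i \<noteq> 0}. i * e i) = (\<Sum>i=1..n. i * e i)"
    if "{i. z i \<noteq> 0} \<subseteq> {1..n}" "\<And>i. z i = 0 \<Longrightarrow> e i = 0" for z e :: "nat \<Rightarrow> nat"
    by (rule sum.mono_neutral_left) (use that in auto)
  have dsum_iff: "is_dsum (free_mod n) (concat (map (\<lambda>i. replicate i (reps i)) [1..<Suc n])) \<longleftrightarrow>
      (\<Sum>i=1..n. i * z i) = n \<and> p dvd (\<Sum>i=1..n. i * e i)"
    if "\<And>i. i \<in> {1..n} \<Longrightarrow> ok (z i) (e i)" "\<And>i. i \<in> {1..n} \<Longrightarrow> reps i \<in> module_class (L (z i) (e i))"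
    for z e reps
  proof -
    have "(\<Prod>i=1..n. prod_list (L (z i) (e i)) ^ i) = (\<Prod>i=1..n. g ^ (i * e i))"
      using that(1) by (intro prod.cong refl) (simp add: prod mult.commute flip: power_mult)
    also have "\<dots> = g ^ (\<Sum>i=1..n. i * e i)" by (simp add: power_sum)
    finally show ?thesis using is_dsum_module_class_iff[OF that(2)] by (simp add: len triv)
  qed
  have "bij_betw \<Phi> (Sigma (part_vecs n) E) W"
  proof (rule bij_betw_imageI)
    show "inj_on \<Phi> (Sigma (part_vecs n) E)"
    proof (rule inj_onI, clarify)
      fix z e z' e' assume z: "z \<in> part_vecs n" and e: "e \<in> E z"
        and z': "z' \<in> part_vecs n" and e': "e' \<in> E z'" and eq: "\<Phi> (z, e) = \<Phi> (z', e')"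
      have "z i = z' i \<and> e i = e' i" for i
      proof (cases "i \<in> {1..n}")
        case True
        then have "module_class (L (z i) (e i)) = module_class (L (z' i) (e' i))"
          using fun_cong[OF eq, of i] by (simp add: \<Phi>_def)
        then show ?thesis using class_inj E_ok e e' by blast
      next
        case False
        then have "z i = 0" "z' i = 0" using supp(2)[OF z] supp(2)[OF z'] by blast+
        then show ?thesis using E_ok[OF e, of i] E_ok[OF e', of i] by (simp add: ok_def)
      qed
      then show "z = z' \<and> e = e'" by auto
    qed
    show "\<Phi> ` Sigma (part_vecs n) E = W"
    proof (intro equalityI subsetI)
      fix Z assume "Z \<in> \<Phi> ` Sigma (part_vecs n) E"
      then obtain z e where z: "z \<in> part_vecs n" and e: "e \<in> E z" and Z: "Z = \<Phi> (z, e)" by auto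
      \<comment> \<open>Every class is nonempty, so representatives exist; \<open>dsum_iff\<close>
        then applies to any choice of them.\<close>
      have "\<exists>Q. Q \<in> module_class (L (z i) (e i))" for i
        using ex_fg_proj_iso_ideal_dsum unfolding module_class_def by blast
      then obtain reps where reps: "\<And>i. reps i \<in> module_class (L (z i) (e i))" by metis
      have "e i = 0" if "z i = 0" for i using E_ok[OF e, of i] that by (simp add: ok_def)
      then have "p dvd (\<Sum>i=1..n. i * e i)"
        using e sum_supp[OF supp(2)[OF z], of e] by (simp add: E_def)
      moreover have "(\<Sum>i=1..n. i * z i) = n" using z by (simp add: part_vecs_def)
      ultimately have "is_dsum (free_mod n) (concat (map (\<lambda>i. replicate i (reps i)) [1..<Suc n]))"
        using dsum_iff[of z e reps] E_ok[OF e] reps by blast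
      then show "Z \<in> W"
        unfolding W_def Z \<Phi>_def using reps
        by (intro CollectI conjI exI[of _ reps]) (simp_all add: fgp_classes_eq del: upt_Suc)
    next
      fix Z assume Z: "Z \<in> W"
      then have "\<forall>i\<in>{1..n}. \<exists>z e. ok z e \<and> Z i = module_class (L z e)"
        unfolding W_def using class_surj by blast
      then obtain z0 e0 where ze: "\<And>i. i \<in> {1..n} \<Longrightarrow> ok (z0 i) (e0 i) \<and> Z i = module_class (L (z0 i) (e0 i))"
        by metis
      \<comment> \<open>The values obtained from \<open>Z\<close> are meaningful only on
        \<open>{1..n}\<close>; they are set to 0 elsewhere, as \<open>part_vecs\<close> and
        \<open>E\<close> demand.\<close>
      define z e where "z i = (if i \<in> {1..n} then z0 i else 0)" and "e i = (if i \<in> {1..n} then e0 i else 0)" for i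
      have ok: "ok (z i) (e i)" for i
        using ze[of i] prime_gt_0_nat[OF assms(2)] by (auto simp: z_def e_def ok_def)
      obtain reps where reps: "\<forall>i\<in>{1..n}. reps i \<in> Z i"
        and ds: "is_dsum (free_mod n) (concat (map (\<lambda>i. replicate i (reps i)) [1..<Suc n]))"
        using Z unfolding W_def by blast
      have "reps i \<in> module_class (L (z i) (e i))" if "i \<in> {1..n}" for i
        using reps ze[OF that] that by (auto simp: z_def e_def)
      then have sums: "(\<Sum>i=1..n. i * z i) = n" "p dvd (\<Sum>i=1..n. i * e i)"
        using dsum_iff[of z e reps] ok ds by auto
      have sub: "{i. z i \<noteq> 0} \<subseteq> {1..n}" by (auto simp: z_def)
      have e0: "e i = 0" if "z i = 0" for i using ok[of i] that by (simp add: ok_def)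
      have "z \<in> part_vecs n" using sums(1) sub by (auto simp: part_vecs_def)
      moreover have "e \<in> E z"
        unfolding E_def using ok e0 sums(2) sum_supp[OF sub, of e] by (auto simp: ok_def)
      moreover have "Z = \<Phi> (z, e)"
      proof
        fix i show "Z i = \<Phi> (z, e) i"
          using ze[of i] Z by (auto simp: \<Phi>_def z_def e_def W_def)
      qed
      ultimately show "Z \<in> \<Phi> ` Sigma (part_vecs n) E" by blast
    qed
  qed
  then have "card W = card (Sigma (part_vecs n) E)" by (metis bij_betw_same_card)
  also have "\<dots> = (\<Sum>z\<in>part_vecs n. card (E z))"
  proof (rule card_SigmaI[OF finite_part_vecs], rule ballI)
    fix z assume z: "z \<in> part_vecs n"
    show "finite (E z)"
      by (rule finite_subset[OF _ card_bounded_functions(2)[OF supp(1)[OF z] prime_gt_0_nat[OF assms(2)]]])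
        (auto simp: E_def)
  qed
  also have "\<dots> = (\<Sum>z\<in>part_vecs n. if \<forall>i. z i \<noteq> 0 \<longrightarrow> p dvd i then p ^ card {i. z i \<noteq> 0}
      else p ^ (card {i. z i \<noteq> 0} - 1))"
    unfolding E_def using card_congruence_solutions[OF assms(2) supp(1)] by (intro sum.cong refl) simp
  also have "\<dots> = (\<Sum>k=1..n. nu_p n k p * p ^ k + nu' n k p * p ^ (k - 1))"
    by (rule sum_part_vecs_by_support[OF assms(4)])
  finally show ?thesis unfolding fe_def mod_rank_free_mod W_def .
qed

end
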